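(* Let $X,Y,A,B$ be inductive families of finite sets, let $\Gamma:C(\Omega_A)\otimes C(\Omega_B)\to L^\infty(\Omega_X)\bar\otimes L^\infty(\Omega_Y)$ be a unital completely positive map, and let $(\Gamma_n)_{n\in\mathbb N}$ be the inductive family associated with $\Gamma$, that is, $\Gamma_n=(\mathcal E_{X_n}^\infty\otimes\mathcal E_{Y_n}^\infty)\circ\Gamma\circ(\iota_A^{(n)}\otimes\iota_B^{(n)})$. The following are equivalent: (i) $\Gamma\in\mathcal C_{\rm ns}(X,Y,A,B)$; (ii) $\Gamma_n\in\mathcal C_{\rm ns}(X_n,Y_n,A_n,B_n)$ for every $n\in\mathbb N$.
   Context: For $d\in\mathbb N$, $[d]=\{1,\dots,d\}$. An inductive family of finite sets is a sequence $X=(X_n)_{n\in\mathbb N}$ of non-empty finite sets with $X_{n+1}=X_n\times[d_n^X]$ for some $d_n^X\in\mathbb N$. Set $d_0^X=|X_1|$ and identify $X_1$ with $[d_0^X]$, so $X_n=\prod_{i=0}^{n-1}[d_i^X]$. Put $\Omega_X=\prod_{i=0}^\infty[d_i^X]$ (product topology), and let $\mu_X$ be the product of the uniform probability measures; $L^\infty(\Omega_X)$ is with respect to $\mu_X$. For $x\in X_n$, $\tilde x\subseteq\Omega_X$ is the cylinder of all points whose first $n$ coordinates form $x$. For a finite set $S$, $\mathcal D_S$ is the algebra of diagonal $|S|\times|S|$ matrices with canonical basis $(\delta_s)_{s\in S}$. The map $\iota_A^{(n)}:\mathcal D_{A_n}\to C(\Omega_A)$ is the unital *-monomorphism $\delta_a\mapsto\chi_{\tilde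 a}$. The map $\mathcal E_{X_n}^\infty:L^\infty(\Omega_X)\to\mathcal D_{X_n}$ is the conditional expectation $f\mapsto\sum_{x\in X_n}|X_n|\left(\int_{\tilde x}f\,d\mu_X\right)\delta_x$. Thus $\Gamma_n:\mathcal D_{A_n}\otimes\mathcal D_{B_n}\to\mathcal D_{X_n}\otimes\mathcal D_{Y_n}$. $\mathcal C_{\rm ns}(X,Y,A,B)$ is the set of unital completely positive maps $\Gamma:C(\Omega_A)\otimes C(\Omega_B)\to L^\infty(\Omega_X)\bar\otimes L^\infty(\Omega_Y)$ with $\Gamma(C(\Omega_A)\otimes1)\subseteq L^\infty(\Omega_X)\otimes1$ and $\Gamma(1\otimes C(\Omega_B))\subseteq1\otimes L^\infty(\Omega_Y)$. For finite sets $S,T,U,V$, $\mathcal C_{\rm ns}(S,T,U,V)$ is identified with the set of unital completely positive maps $\Lambda:\mathcal D_U\otimes\mathcal D_V\to\mathcal D_S\otimes\mathcal D_T$ with $\Lambda(\mathcal D_U\otimes1)\subseteq\mathcal D_S\otimes1$ and $\Lambda(1\otimes\mathcal D_V)\subseteq1\otimes\mathcal D_T$. *)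

theory Defs
  imports "HOL-Probability.Probability" "HOL-Algebra.Module"
begin

section \<open>Completely positive maps between *-algebras\<close>

record 'a star_algebra = "(complex, 'a) module" +
  star :: "'a \<Rightarrow> 'a"

definition linear_map ::
    "('a, 'm) star_algebra_scheme \<Rightarrow> ('b, 'n) star_algebra_scheme \<Rightarrow> ('a \<Rightarrow> 'b) \<Rightarrow> bool" where
  "linear_map A B T \<longleftrightarrow>
     T \<in> carrier A \<rightarrow> carrier B \<and>
     (\<forall>a\<in>carrier A. \<forall>b\<in>carrier A. T (a \<oplus>\<^bsub>A\<^esub> b) = T a \<oplus>\<^bsub>B\<^esub> T b) \<and>
     (\<forall>c. \<forall>a\<in>carrier A. T (c \<odot>\<^bsub>A\<^esub> a) = c \<odot>\<^bsub>B\<^esub> T a)"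

(* P is positive in the matrix algebra M_k(A), i.e. P = C* C for some C in M_k(A);
   only the entries with indices below k matter. *)
definition positive_matrix ::
    "('a, 'm) star_algebra_scheme \<Rightarrow> nat \<Rightarrow> (nat \<Rightarrow> nat \<Rightarrow> 'a) \<Rightarrow> bool" where
  "positive_matrix A k P \<longleftrightarrow>
     (\<exists>C. (\<forall>i<k. \<forall>j<k. C i j \<in> carrier A) \<and>
          (\<forall>i<k. \<forall>j<k. P i j = (\<Oplus>\<^bsub>A\<^esub>l\<in>{..<k}. star A (C l i) \<otimes>\<^bsub>A\<^esub> C l j)))"

definition completely_positive ::
    "('a, 'm) star_algebra_scheme \<Rightarrow> ('b, 'n) star_algebra_scheme \<Rightarrow> ('a \<Rightarrow> 'b) \<Rightarrow> bool" where
  "completely_positive A B T \<longleftrightarrow>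
     linear_map A B T \<and>
     (\<forall>k\<ge>1. \<forall>P. (\<forall>i<k. \<forall>j<k. P i j \<in> carrier A) \<longrightarrow> positive_matrix A k P \<longrightarrow>
        positive_matrix B k (\<lambda>i j. T (P i j)))"

definition ucp ::
    "('a, 'm) star_algebra_scheme \<Rightarrow> ('b, 'n) star_algebra_scheme \<Rightarrow> ('a \<Rightarrow> 'b) \<Rightarrow> bool" where
  "ucp A B T \<longleftrightarrow> completely_positive A B T \<and> T \<one>\<^bsub>A\<^esub> = \<one>\<^bsub>B\<^esub>"


section \<open>Algebras of continuous functions and diagonal matrices\<close>

definition fun_algebra :: "'a set \<Rightarrow> ('a \<Rightarrow> complex) set \<Rightarrow> ('a \<Rightarrow> complex) star_algebra" where
  "fun_algebra K F =
     \<lparr>carrier = F,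
      mult = (\<lambda>f g. \<lambda>x\<in>K. f x * g x),
      one = (\<lambda>x\<in>K. 1),
      zero = (\<lambda>x\<in>K. 0),
      add = (\<lambda>f g. \<lambda>x\<in>K. f x + g x),
      smult = (\<lambda>c f. \<lambda>x\<in>K. c * f x),
      star = (\<lambda>f. \<lambda>x\<in>K. cnj (f x))\<rparr>"

definition C_alg :: "'a topology \<Rightarrow> ('a \<Rightarrow> complex) star_algebra" where
  "C_alg T = fun_algebra (topspace T) {f \<in> extensional (topspace T). continuous_map T euclidean f}"

(* A diagonal matrix indexed by S is represented by its diagonal, a function on S. *)
definition diag_alg :: "'a set \<Rightarrow> ('a \<Rightarrow> complex) star_algebra" where
  "diag_alg S = fun_algebra S (extensional S)"

(* Elementary tensors, under C(K) \<otimes> C(L) = C(K \<times> L) and D_S \<otimes> D_T = D_{S \<times> T}. *)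
definition fun_tensor ::
    "'a set \<Rightarrow> 'b set \<Rightarrow> ('a \<Rightarrow> complex) \<Rightarrow> ('b \<Rightarrow> complex) \<Rightarrow> ('a \<times> 'b \<Rightarrow> complex)" where
  "fun_tensor K L f g = (\<lambda>(x, y)\<in>K \<times> L. f x * g y)"


section \<open>The algebra of essentially bounded functions\<close>

definition linf_fun :: "'a measure \<Rightarrow> ('a \<Rightarrow> complex) set" where
  "linf_fun M = {f \<in> borel_measurable M. \<exists>c. AE x in M. norm (f x) \<le> c}"

definition ae_rel :: "'a measure \<Rightarrow> (('a \<Rightarrow> complex) \<times> ('a \<Rightarrow> complex)) set" where
  "ae_rel M = {(f, g). f \<in> linf_fun M \<and> g \<in> linf_fun M \<and> (AE x in M. f x = g x)}"

definition linf_class :: "'a measure \<Rightarrow> ('a \<Rightarrow> complex) \<Rightarrow> ('a \<Rightarrow> complex) set" where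
  "linf_class M f = ae_rel M `` {f}"

definition rep :: "('a \<Rightarrow> complex) set \<Rightarrow> 'a \<Rightarrow> complex" where
  "rep F = (SOME f. f \<in> F)"

definition Linf_alg :: "'a measure \<Rightarrow> ('a \<Rightarrow> complex) set star_algebra" where
  "Linf_alg M =
     \<lparr>carrier = linf_fun M // ae_rel M,
      mult = (\<lambda>F G. linf_class M (\<lambda>x. rep F x * rep G x)),
      one = linf_class M (\<lambda>x. 1),
      zero = linf_class M (\<lambda>x. 0),
      add = (\<lambda>F G. linf_class M (\<lambda>x. rep F x + rep G x)),
      smult = (\<lambda>c F. linf_class M (\<lambda>x. c * rep F x)),
      star = (\<lambda>F. linf_class M (\<lambda>x. cnj (rep F x)))\<rparr>"

(* Elementary tensors, under the identification of the von Neumann algebra tensor product of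
   L^\<infinity>(M) and L^\<infinity>(N) with L^\<infinity>(M \<times> N) for the product measure. *)
definition linf_tensor :: "'a measure \<Rightarrow> 'b measure \<Rightarrow>
    ('a \<Rightarrow> complex) set \<Rightarrow> ('b \<Rightarrow> complex) set \<Rightarrow> ('a \<times> 'b \<Rightarrow> complex) set" where
  "linf_tensor M N F G = linf_class (M \<Otimes>\<^sub>M N) (\<lambda>(x, y). rep F x * rep G y)"

lemma equiv_ae_rel: "equiv (linf_fun M) (ae_rel M)"
proof (rule equivI)
  show "refl_on (linf_fun M) (ae_rel M)" by (auto simp: refl_on_def ae_rel_def)
  show "sym (ae_rel M)" by (auto simp: sym_def ae_rel_def elim: eventually_mono)
  show "trans (ae_rel M)"
  proof (rule transI)
    fix f g h assume "(f, g) \<in> ae_rel M" "(g, h) \<in> ae_rel M"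
    then show "(f, h) \<in> ae_rel M"
      by (auto simp: ae_rel_def elim: eventually_elim2)
  qed
qed (auto simp: ae_rel_def)

lemma rep_linf_class:
  assumes "f \<in> linf_fun M"
  shows "rep (linf_class M f) \<in> linf_fun M" "AE x in M. rep (linf_class M f) x = f x"
proof -
  have "f \<in> linf_class M f" using assms by (auto simp: linf_class_def ae_rel_def)
  then have "rep (linf_class M f) \<in> linf_class M f" unfolding rep_def by (metis someI)
  then show "rep (linf_class M f) \<in> linf_fun M" "AE x in M. rep (linf_class M f) x = f x"
    by (auto simp: linf_class_def ae_rel_def elim: eventually_mono)
qed

lemma rep_in_linf_fun:
  assumes "F \<in> carrier (Linf_alg M)"
  shows "rep F \<in> linf_fun M"
proof -
  from assms obtain f where "f \<in> linf_fun M" "F = linf_class M f"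
    by (auto simp: Linf_alg_def linf_class_def elim: quotientE)
  then show ?thesis using rep_linf_class by simp
qed


section \<open>Inductive families of finite sets\<close>

(* An inductive family X is encoded by the sequence d with d 0 = |X_1|; then
   X_n = [d 0] \<times> ... \<times> [d (n - 1)], for n \<ge> 1, is level d n. *)
definition inductive_family :: "(nat \<Rightarrow> nat) \<Rightarrow> bool" where
  "inductive_family d \<longleftrightarrow> (\<forall>i. 1 \<le> d i)"

definition level :: "(nat \<Rightarrow> nat) \<Rightarrow> nat \<Rightarrow> (nat \<Rightarrow> nat) set" where
  "level d n = (\<Pi>\<^sub>E i\<in>{..<n}. {1..d i})"

definition Omega :: "(nat \<Rightarrow> nat) \<Rightarrow> (nat \<Rightarrow> nat) set" where
  "Omega d = (\<Pi>\<^sub>E i\<in>UNIV. {1..d i})"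

definition Omega_top :: "(nat \<Rightarrow> nat) \<Rightarrow> (nat \<Rightarrow> nat) topology" where
  "Omega_top d = product_topology (\<lambda>i. discrete_topology {1..d i}) UNIV"

definition mu :: "(nat \<Rightarrow> nat) \<Rightarrow> (nat \<Rightarrow> nat) measure" where
  "mu d = (\<Pi>\<^sub>M i\<in>UNIV. uniform_count_measure {1..d i})"

definition cyl :: "(nat \<Rightarrow> nat) \<Rightarrow> nat \<Rightarrow> (nat \<Rightarrow> nat) \<Rightarrow> (nat \<Rightarrow> nat) set" where
  "cyl d n x = {\<omega> \<in> Omega d. restrict \<omega> {..<n} = x}"

definition cyl_embed :: "(nat \<Rightarrow> nat) \<Rightarrow> nat \<Rightarrow> ((nat \<Rightarrow> nat) \<Rightarrow> complex) \<Rightarrow> (nat \<Rightarrow> nat) \<Rightarrow> complex"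
  where "cyl_embed d n \<phi> = (\<lambda>\<omega>\<in>Omega d. \<Sum>a\<in>level d n. \<phi> a * indicator (cyl d n a) \<omega>)"

(* The map \<iota>_A \<otimes> \<iota>_B, sending \<delta>_a \<otimes> \<delta>_b to \<chi> \<otimes> \<chi> for the two cylinders; see cyl_embed2_tensor. *)
definition cyl_embed2 :: "(nat \<Rightarrow> nat) \<Rightarrow> (nat \<Rightarrow> nat) \<Rightarrow> nat \<Rightarrow>
    ((nat \<Rightarrow> nat) \<times> (nat \<Rightarrow> nat) \<Rightarrow> complex) \<Rightarrow> (nat \<Rightarrow> nat) \<times> (nat \<Rightarrow> nat) \<Rightarrow> complex" where
  "cyl_embed2 dA dB n \<phi> = (\<lambda>\<omega>\<in>Omega dA \<times> Omega dB.
     \<Sum>(a, b)\<in>level dA n \<times> level dB n. \<phi> (a, b) * indicator (cyl dA n a \<times> cyl dB n b) \<omega>)"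

definition cond_exp :: "(nat \<Rightarrow> nat) \<Rightarrow> nat \<Rightarrow> ((nat \<Rightarrow> nat) \<Rightarrow> complex) set \<Rightarrow> (nat \<Rightarrow> nat) \<Rightarrow> complex"
  where "cond_exp d n F =
    (\<lambda>x\<in>level d n. of_nat (card (level d n)) * (LINT \<omega>:cyl d n x|mu d. rep F \<omega>))"

(* The tensor product of the conditional expectations for X and Y: the conditional expectation of
   L^\<infinity>(\<Omega>_X \<times> \<Omega>_Y) onto the span of the products of cylinders; see cond_exp2_tensor. *)
definition cond_exp2 :: "(nat \<Rightarrow> nat) \<Rightarrow> (nat \<Rightarrow> nat) \<Rightarrow> nat \<Rightarrow>
    ((nat \<Rightarrow> nat) \<times> (nat \<Rightarrow> nat) \<Rightarrow> complex) set \<Rightarrow> (nat \<Rightarrow> nat) \<times> (nat \<Rightarrow> nat) \<Rightarrow> complex" where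
  "cond_exp2 dX dY n F = (\<lambda>(x, y)\<in>level dX n \<times> level dY n.
     of_nat (card (level dX n)) * of_nat (card (level dY n)) *
     (LINT \<omega>:cyl dX n x \<times> cyl dY n y|mu dX \<Otimes>\<^sub>M mu dY. rep F \<omega>))"

lemma finite_level: "finite (level d n)"
  by (auto simp: level_def intro!: finite_PiE)

lemma cyl_embed2_tensor:
  "cyl_embed2 dA dB n (fun_tensor (level dA n) (level dB n) \<phi> \<psi>) =
   fun_tensor (Omega dA) (Omega dB) (cyl_embed dA n \<phi>) (cyl_embed dB n \<psi>)"
proof
  fix w :: "(nat \<Rightarrow> nat) \<times> (nat \<Rightarrow> nat)"
  obtain u v where w: "w = (u, v)" by (cases w)
  show "cyl_embed2 dA dB n (fun_tensor (level dA n) (level dB n) \<phi> \<psi>) w =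
     fun_tensor (Omega dA) (Omega dB) (cyl_embed dA n \<phi>) (cyl_embed dB n \<psi>) w"
    unfolding w
    by (auto simp: cyl_embed2_def cyl_embed_def fun_tensor_def sum_product sum.cartesian_product
        indicator_times intro!: sum.cong)
qed

lemma prob_space_mu: "inductive_family d \<Longrightarrow> prob_space (mu d)"
  unfolding mu_def inductive_family_def
  by (intro prob_space_PiM prob_space_uniform_count_measure) auto

lemma sets_cyl [measurable]: "cyl d n x \<in> sets (mu d)"
proof (cases "x \<in> extensional {..<n}")
  case True
  have "cyl d n x = {\<omega> \<in> space (mu d). \<forall>i\<in>{..<n}. \<omega> i = x i}"
    using True
    by (auto simp: cyl_def Omega_def mu_def space_PiM space_uniform_count_measure fun_eq_iff
        extensional_def restrict_def)
  also have "\<dots> \<in> sets (mu d)"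
  proof (rule sets.sets_Collect_finite_All)
    fix i
    have "(\<lambda>\<omega>. \<omega> i) \<in> measurable (mu d) (uniform_count_measure {1..d i})"
      unfolding mu_def by (rule measurable_component_singleton) simp
    then have "(\<lambda>\<omega>. \<omega> i) -` ({x i} \<inter> {1..d i}) \<inter> space (mu d) \<in> sets (mu d)"
      by (rule measurable_sets) (auto simp: sets_uniform_count_measure)
    also have "(\<lambda>\<omega>. \<omega> i) -` ({x i} \<inter> {1..d i}) \<inter> space (mu d) = {\<omega> \<in> space (mu d). \<omega> i = x i}"
      by (auto simp: mu_def space_PiM space_uniform_count_measure dest: PiE_mem[where x = i])
    finally show "{\<omega> \<in> space (mu d). \<omega> i = x i} \<in> sets (mu d)" .
  qed simp
  finally show ?thesis .
next
  case False
  then have "cyl d n x = {}" by (auto simp: cyl_def)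
  then show ?thesis by simp
qed

lemma cond_exp2_tensor:
  assumes "inductive_family dX" "inductive_family dY"
    and F: "F \<in> carrier (Linf_alg (mu dX))" and G: "G \<in> carrier (Linf_alg (mu dY))"
  shows "cond_exp2 dX dY n (linf_tensor (mu dX) (mu dY) F G) =
    fun_tensor (level dX n) (level dY n) (cond_exp dX n F) (cond_exp dY n G)"
proof -
  interpret X: prob_space "mu dX" using assms by (simp add: prob_space_mu)
  interpret Y: prob_space "mu dY" using assms by (simp add: prob_space_mu)
  interpret XY: pair_prob_space "mu dX" "mu dY" ..
  have [measurable]: "rep F \<in> borel_measurable (mu dX)" "rep G \<in> borel_measurable (mu dY)"
    using rep_in_linf_fun[OF F] rep_in_linf_fun[OF G] by (auto simp: linf_fun_def)
  obtain c where c: "AE x in mu dX. norm (rep F x) \<le> c"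
    using rep_in_linf_fun[OF F] by (auto simp: linf_fun_def)
  obtain c' where c': "AE x in mu dY. norm (rep G x) \<le> c'"
    using rep_in_linf_fun[OF G] by (auto simp: linf_fun_def)
  let ?h = "\<lambda>(x, y). rep F x * rep G y"
  have c2: "AE w in mu dX \<Otimes>\<^sub>M mu dY. norm (rep F (fst w)) \<le> c"
    by (rule XY.AE_pair_measure) (use c in \<open>auto elim: eventually_mono\<close>)
  have c2': "AE w in mu dX \<Otimes>\<^sub>M mu dY. norm (rep G (snd w)) \<le> c'"
    by (rule XY.AE_pair_measure) (use c' in \<open>auto elim: eventually_mono\<close>)
  have hL: "?h \<in> linf_fun (mu dX \<Otimes>\<^sub>M mu dY)"
    unfolding linf_fun_def
  proof (intro CollectI conjI exI)
    show "AE w in mu dX \<Otimes>\<^sub>M mu dY. norm (?h w) \<le> c * c'"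
      using c2 c2'
    proof eventually_elim
      case (elim w)
      then show ?case
        using mult_mono[OF elim] order_trans[OF norm_ge_zero elim(1)]
        by (auto simp: case_prod_unfold norm_mult)
    qed
  qed measurable
  have eq: "(LINT \<omega>:cyl dX n x \<times> cyl dY n y|mu dX \<Otimes>\<^sub>M mu dY.
        rep (linf_tensor (mu dX) (mu dY) F G) \<omega>) =
      (LINT \<omega>:cyl dX n x|mu dX. rep F \<omega>) * (LINT \<omega>:cyl dY n y|mu dY. rep G \<omega>)" for x y
  proof -
    let ?R = "rep (linf_tensor (mu dX) (mu dY) F G)"
    have R: "?R \<in> linf_fun (mu dX \<Otimes>\<^sub>M mu dY)" "AE w in mu dX \<Otimes>\<^sub>M mu dY. ?R w = ?h w"
      unfolding linf_tensor_def using rep_linf_class[OF hL] by auto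
    have [measurable]: "?R \<in> borel_measurable (mu dX \<Otimes>\<^sub>M mu dY)"
      using R(1) by (simp add: linf_fun_def)
    have "(LINT \<omega>:cyl dX n x \<times> cyl dY n y|mu dX \<Otimes>\<^sub>M mu dY. ?R \<omega>) =
        (LINT \<omega>:cyl dX n x \<times> cyl dY n y|mu dX \<Otimes>\<^sub>M mu dY. ?h \<omega>)"
      unfolding set_lebesgue_integral_def
      by (rule integral_cong_AE) (use R(2) in \<open>auto elim: eventually_mono\<close>)
    also have "\<dots> = (LINT w|(mu dX \<Otimes>\<^sub>M mu dY).
        (indicator (cyl dX n x) (fst w) *\<^sub>R rep F (fst w)) *
        (indicator (cyl dY n y) (snd w) *\<^sub>R rep G (snd w)))"
      unfolding set_lebesgue_integral_def
      by (rule Bochner_Integration.integral_cong)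
        (auto simp: case_prod_unfold indicator_def mem_Times_iff)
    also have "\<dots> = (LINT u|mu dX. LINT v|mu dY.
        (indicator (cyl dX n x) u *\<^sub>R rep F u) * (indicator (cyl dY n y) v *\<^sub>R rep G v))"
    proof (subst XY.integral_fst'[symmetric])
      show "integrable (mu dX \<Otimes>\<^sub>M mu dY) (\<lambda>w.
        (indicator (cyl dX n x) (fst w) *\<^sub>R rep F (fst w)) *
        (indicator (cyl dY n y) (snd w) *\<^sub>R rep G (snd w)))"
      proof (rule XY.P.integrable_const_bound)
        show "AE w in mu dX \<Otimes>\<^sub>M mu dY. norm
          ((indicator (cyl dX n x) (fst w) *\<^sub>R rep F (fst w)) *
           (indicator (cyl dY n y) (snd w) *\<^sub>R rep G (snd w))) \<le> c * c'"
          using c2 c2'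
        proof eventually_elim
          case (elim w)
          have "0 \<le> c" "0 \<le> c'" using elim norm_ge_zero order_trans by blast+
          then show ?case
            using mult_mono[OF elim] by (auto simp: indicator_def norm_mult)
        qed
      qed measurable
    qed simp
    also have "\<dots> = (LINT \<omega>:cyl dX n x|mu dX. rep F \<omega>) * (LINT \<omega>:cyl dY n y|mu dY. rep G \<omega>)"
      by (simp only: set_lebesgue_integral_def integral_mult_right_zero integral_mult_left_zero)
    finally show ?thesis .
  qed
  show ?thesis
    by (auto simp: cond_exp2_def cond_exp_def fun_tensor_def eq fun_eq_iff)
qed


section \<open>No-signalling maps\<close>

definition C_ns_fin :: "'s set \<Rightarrow> 't set \<Rightarrow> 'u set \<Rightarrow> 'v set \<Rightarrow>
    (('u \<times> 'v \<Rightarrow> complex) \<Rightarrow> ('s \<times> 't \<Rightarrow> complex)) set" where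
  "C_ns_fin S T U V = {\<Lambda>. ucp (diag_alg (U \<times> V)) (diag_alg (S \<times> T)) \<Lambda> \<and>
     (\<lambda>f. \<Lambda> (fun_tensor U V f \<one>\<^bsub>diag_alg V\<^esub>)) ` carrier (diag_alg U)
       \<subseteq> (\<lambda>g. fun_tensor S T g \<one>\<^bsub>diag_alg T\<^esub>) ` carrier (diag_alg S) \<and>
     (\<lambda>f. \<Lambda> (fun_tensor U V \<one>\<^bsub>diag_alg U\<^esub> f)) ` carrier (diag_alg V)
       \<subseteq> (\<lambda>g. fun_tensor S T \<one>\<^bsub>diag_alg S\<^esub> g) ` carrier (diag_alg T)}"

abbreviation C_tensor_alg where
  "C_tensor_alg dA dB \<equiv> C_alg (prod_topology (Omega_top dA) (Omega_top dB))"

abbreviation Linf_tensor_alg where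
  "Linf_tensor_alg dX dY \<equiv> Linf_alg (mu dX \<Otimes>\<^sub>M mu dY)"

definition C_ns :: "(nat \<Rightarrow> nat) \<Rightarrow> (nat \<Rightarrow> nat) \<Rightarrow> (nat \<Rightarrow> nat) \<Rightarrow> (nat \<Rightarrow> nat) \<Rightarrow>
    (((nat \<Rightarrow> nat) \<times> (nat \<Rightarrow> nat) \<Rightarrow> complex) \<Rightarrow> ((nat \<Rightarrow> nat) \<times> (nat \<Rightarrow> nat) \<Rightarrow> complex) set) set" where
  "C_ns dX dY dA dB = {\<Gamma>. ucp (C_tensor_alg dA dB) (Linf_tensor_alg dX dY) \<Gamma> \<and>
     (\<lambda>f. \<Gamma> (fun_tensor (Omega dA) (Omega dB) f \<one>\<^bsub>C_alg (Omega_top dB)\<^esub>))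
         ` carrier (C_alg (Omega_top dA))
       \<subseteq> (\<lambda>g. linf_tensor (mu dX) (mu dY) g \<one>\<^bsub>Linf_alg (mu dY)\<^esub>) ` carrier (Linf_alg (mu dX)) \<and>
     (\<lambda>f. \<Gamma> (fun_tensor (Omega dA) (Omega dB) \<one>\<^bsub>C_alg (Omega_top dA)\<^esub> f))
         ` carrier (C_alg (Omega_top dB))
       \<subseteq> (\<lambda>g. linf_tensor (mu dX) (mu dY) \<one>\<^bsub>Linf_alg (mu dX)\<^esub> g) ` carrier (Linf_alg (mu dY))}"

definition assoc_family :: "(nat \<Rightarrow> nat) \<Rightarrow> (nat \<Rightarrow> nat) \<Rightarrow> (nat \<Rightarrow> nat) \<Rightarrow> (nat \<Rightarrow> nat) \<Rightarrow>
    (((nat \<Rightarrow> nat) \<times> (nat \<Rightarrow> nat) \<Rightarrow> complex) \<Rightarrow> ((nat \<Rightarrow> nat) \<times> (nat \<Rightarrow> nat) \<Rightarrow> complex) set) \<Rightarrow>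
    nat \<Rightarrow> ((nat \<Rightarrow> nat) \<times> (nat \<Rightarrow> nat) \<Rightarrow> complex) \<Rightarrow> ((nat \<Rightarrow> nat) \<times> (nat \<Rightarrow> nat) \<Rightarrow> complex)" where
  "assoc_family dX dY dA dB \<Gamma> n = cond_exp2 dX dY n \<circ> \<Gamma> \<circ> cyl_embed2 dA dB n"

end

theory Submission
  imports Defs
begin

text \<open>
  A function in \<open>C(\<Omega>\<^sub>A)\<close> depends, up to a small uniform error, on finitely many coordinates only, and
  an element of \<open>L\<^sup>\<infinity>(\<Omega>\<^sub>X \<times> \<Omega>\<^sub>Y)\<close> is determined by its integrals over products of cylinders.
  The first fact says that the maps \<open>\<Gamma>\<^sub>n\<close> see a dense part of the domain of \<open>\<Gamma>\<close>, the second that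
  the conditional expectations separate the points of its range; together they allow the
  no-signalling conditions to be passed between \<open>\<Gamma>\<close> and its associated family.

  From \<open>\<Gamma>\<close> to \<open>\<Gamma>\<^sub>n\<close>, both the cylinder embedding and the conditional expectation respect
  elementary tensors and units, so the no-signalling conditions descend directly. That \<open>\<Gamma>\<^sub>n\<close> is unital
  completely positive needs more: the embedding is a *-homomorphism, while a conditional
  expectation integrates a matrix of the form \<open>C\<^sup>* C\<close> over a rectangle of cylinders. The result is
  positive semidefinite, and a Cholesky factorisation (\<open>pos_semidef_factorisation\<close>) turns it
  back into the form that the definition of positivity asks for.

  From the \<open>\<Gamma>\<^sub>n\<close> to \<open>\<Gamma>\<close>, let \<open>f\<close> depend on the first \<open>k\<close> coordinates and let \<open>F = \<Gamma>(f \<otimes> 1)\<close>.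
  At every level \<open>m \<ge> k\<close> the no-signalling condition for \<open>\<Gamma>\<^sub>m\<close> says that the integral of \<open>F\<close> over
  the product of the cylinders of \<open>x\<close> and \<open>y\<close> does not depend on \<open>y\<close>. Hence \<open>F\<close> and
  \<open>(x, y) \<mapsto> \<integral> F(x, v) d\<mu>(v)\<close> have the same integrals over all such products, and they agree almost
  everywhere (\<open>AE_eq_slice_fst\<close>). For a general continuous \<open>f\<close>, approximate it uniformly by such
  functions (\<open>cyl_embed_dense\<close>). A unital completely positive map is bounded
  (\<open>ucp_norm_bound\<close>), and the functions of one coordinate are closed under uniform limits
  (\<open>factors_through_limit\<close>). The second no-signalling condition is symmetric.
\<close>

section \<open>Algebras of functions\<close>

lemma fun_algebra_sel [simp]:
  "carrier (fun_algebra K F) = F"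
  "\<one>\<^bsub>fun_algebra K F\<^esub> = (\<lambda>x\<in>K. 1)"
  "\<zero>\<^bsub>fun_algebra K F\<^esub> = (\<lambda>x\<in>K. 0)"
  "f \<otimes>\<^bsub>fun_algebra K F\<^esub> g = (\<lambda>x\<in>K. f x * g x)"
  "f \<oplus>\<^bsub>fun_algebra K F\<^esub> g = (\<lambda>x\<in>K. f x + g x)"
  "c \<odot>\<^bsub>fun_algebra K F\<^esub> f = (\<lambda>x\<in>K. c * f x)"
  "star (fun_algebra K F) f = (\<lambda>x\<in>K. cnj (f x))"
  by (simp_all add: fun_algebra_def)

text \<open>
These closure properties keep the sums \<open>C\<^sup>* C\<close> inside \<open>F\<close>. They hold both for diagonal matrices
and for continuous functions, so that positivity of matrices can be unfolded once for both.
\<close>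

definition fun_star_closed :: "'a set \<Rightarrow> ('a \<Rightarrow> complex) set \<Rightarrow> bool" where
  "fun_star_closed K F \<longleftrightarrow> F \<subseteq> extensional K \<and> (\<lambda>x\<in>K. 0) \<in> F \<and>
     (\<forall>f\<in>F. \<forall>g\<in>F. (\<lambda>x\<in>K. f x + g x) \<in> F \<and> (\<lambda>x\<in>K. f x * g x) \<in> F) \<and>
     (\<forall>f\<in>F. (\<lambda>x\<in>K. cnj (f x)) \<in> F)"

lemma abelian_monoid_fun_algebra:
  assumes "fun_star_closed K F"
  shows "abelian_monoid (fun_algebra K F)"
proof (rule abelian_monoidI)
  fix f assume "f \<in> carrier (fun_algebra K F)"
  then have "f \<in> extensional K" using assms by (auto simp: fun_star_closed_def)
  then show "\<zero>\<^bsub>fun_algebra K F\<^esub> \<oplus>\<^bsub>fun_algebra K F\<^esub> f = f"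
    by (auto simp: fun_eq_iff extensional_def)
qed (use assms in \<open>auto simp: fun_star_closed_def fun_eq_iff\<close>)

lemma finsum_fun_algebra:
  assumes F: "fun_star_closed K F" and "finite I" and "\<And>l. l \<in> I \<Longrightarrow> f l \<in> F"
  shows "finsum (fun_algebra K F) f I = (\<lambda>x\<in>K. \<Sum>l\<in>I. f l x)"
  using assms(2,3)
proof (induction I)
  case empty
  interpret abelian_monoid "fun_algebra K F" using F by (rule abelian_monoid_fun_algebra)
  show ?case by simp
next
  case (insert a I)
  interpret abelian_monoid "fun_algebra K F" using F by (rule abelian_monoid_fun_algebra)
  have "finsum (fun_algebra K F) f (insert a I)
      = f a \<oplus>\<^bsub>fun_algebra K F\<^esub> finsum (fun_algebra K F) f I"
    using insert by (intro finsum_insert) auto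
  also have "\<dots> = (\<lambda>x\<in>K. \<Sum>l\<in>insert a I. f l x)"
    using insert by (auto simp: fun_eq_iff)
  finally show ?case .
qed

text \<open>
The sum over the rows of \<open>C\<close> is a sum in the algebra; pointwise it is the ordinary sum of complex
numbers, so positivity over an algebra of functions is a pointwise factorisation whose factors lie
in the algebra.
\<close>

lemma positive_matrix_fun_algebra:
  assumes F: "fun_star_closed K F"
  shows "positive_matrix (fun_algebra K F) k P \<longleftrightarrow>
    (\<exists>C. (\<forall>i<k. \<forall>j<k. C i j \<in> F) \<and>
         (\<forall>i<k. \<forall>j<k. P i j = (\<lambda>x\<in>K. \<Sum>l<k. cnj (C l i x) * C l j x)))"
proof -
  have eq: "(\<Oplus>\<^bsub>fun_algebra K F\<^esub>l\<in>{..<k}.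
      star (fun_algebra K F) (C l i) \<otimes>\<^bsub>fun_algebra K F\<^esub> C l j) =
      (\<lambda>x\<in>K. \<Sum>l<k. cnj (C l i x) * C l j x)"
    if "\<forall>i<k. \<forall>j<k. C i j \<in> F" "i < k" "j < k" for C i j
  proof -
    have "star (fun_algebra K F) (C l i) \<otimes>\<^bsub>fun_algebra K F\<^esub> C l j \<in> F" if "l < k" for l
      using F \<open>\<forall>i<k. \<forall>j<k. C i j \<in> F\<close> \<open>i < k\<close> \<open>j < k\<close> that
      unfolding fun_star_closed_def fun_algebra_sel by blast
    then show ?thesis
      by (subst finsum_fun_algebra[OF F]) (auto simp: fun_eq_iff intro!: sum.cong)
  qed
  show ?thesis
    unfolding positive_matrix_def fun_algebra_sel(1)
    by (intro ex_cong1 conj_cong refl all_cong1 imp_cong) (simp add: eq del: fun_algebra_sel)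
qed

lemma fun_star_closed_extensional: "fun_star_closed S (extensional S)"
  by (auto simp: fun_star_closed_def)

lemma continuous_map_restrict:
  "continuous_map T euclidean (restrict f (topspace T)) \<longleftrightarrow> continuous_map T euclidean f"
  using continuous_map_eq[of T euclidean f "restrict f (topspace T)"]
    continuous_map_eq[of T euclidean "restrict f (topspace T)" f] by auto

lemma fun_star_closed_continuous:
  "fun_star_closed (topspace T)
     {f \<in> extensional (topspace T). continuous_map T euclidean f}"
  by (simp add: fun_star_closed_def continuous_map_restrict)
    (simp add: continuous_map_atin tendsto_mult tendsto_add tendsto_cnj)

section \<open>Essentially bounded functions\<close>

text \<open>
With the following lemmas this allows computations in \<open>Linf_alg M\<close> to be carried out on
representatives, up to null sets.
\<close>

lemma linf_class_eq_iff:
  assumes "f \<in> linf_fun M" "g \<in> linf_fun M"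
  shows "linf_class M f = linf_class M g \<longleftrightarrow> (AE x in M. f x = g x)"
  using eq_equiv_class_iff[OF equiv_ae_rel[of M] assms] assms
  by (auto simp: linf_class_def ae_rel_def)

lemma linf_class_rep:
  assumes "F \<in> carrier (Linf_alg M)"
  shows "linf_class M (rep F) = F"
proof -
  from assms obtain f where f: "f \<in> linf_fun M" "F = linf_class M f"
    by (auto simp: Linf_alg_def linf_class_def elim: quotientE)
  then show ?thesis
    using linf_class_eq_iff[OF rep_linf_class(1)[OF f(1)] f(1)] rep_linf_class(2)[OF f(1)] by simp
qed

lemma linf_class_in_carrier: "f \<in> linf_fun M \<Longrightarrow> linf_class M f \<in> carrier (Linf_alg M)"
  by (simp add: Linf_alg_def linf_class_def quotientI)

lemma linf_funI:
  assumes "f \<in> borel_measurable M" "AE x in M. norm (f x) \<le> c"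
  shows "f \<in> linf_fun M"
  using assms by (auto simp: linf_fun_def)

lemma linf_fun_const: "(\<lambda>_. c) \<in> linf_fun M"
  by (rule linf_funI[where c = "norm c"]) auto

lemma linf_fun_cnj: "f \<in> linf_fun M \<Longrightarrow> (\<lambda>x. cnj (f x)) \<in> linf_fun M"
  using measurable_compose[of f M borel cnj borel] borel_measurable_continuous_onI[of cnj]
  by (auto simp: linf_fun_def continuous_on_cnj)

lemma linf_fun_add:
  assumes "f \<in> linf_fun M" "g \<in> linf_fun M"
  shows "(\<lambda>x. f x + g x) \<in> linf_fun M"
proof -
  obtain c d where c: "AE x in M. norm (f x) \<le> c" and d: "AE x in M. norm (g x) \<le> d"
    using assms by (auto simp: linf_fun_def)
  show ?thesis
  proof (rule linf_funI)
    show "AE x in M. norm (f x + g x) \<le> c + d"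
      using c d by eventually_elim (rule norm_triangle_mono)
  qed (use assms in \<open>auto simp: linf_fun_def\<close>)
qed

lemma linf_fun_mult:
  assumes "f \<in> linf_fun M" "g \<in> linf_fun M"
  shows "(\<lambda>x. f x * g x) \<in> linf_fun M"
proof -
  obtain c d where c: "AE x in M. norm (f x) \<le> c" and d: "AE x in M. norm (g x) \<le> d"
    using assms by (auto simp: linf_fun_def)
  show ?thesis
  proof (rule linf_funI)
    show "AE x in M. norm (f x * g x) \<le> c * d"
      using c d
    proof eventually_elim
      case (elim x)
      then show ?case
        using mult_mono[OF elim] order_trans[OF norm_ge_zero elim(1)] by (simp add: norm_mult)
    qed
  qed (use assms in \<open>auto simp: linf_fun_def\<close>)
qed

lemma Linf_eqI:
  assumes "F \<in> carrier (Linf_alg M)" "G \<in> carrier (Linf_alg M)" "AE x in M. rep F x = rep G x"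
  shows "F = G"
  using linf_class_eq_iff[OF rep_in_linf_fun[OF assms(1)] rep_in_linf_fun[OF assms(2)]] assms
  by (simp add: linf_class_rep)

lemma rep_zero: "AE x in M. rep (\<zero>\<^bsub>Linf_alg M\<^esub>) x = 0"
  using rep_linf_class(2)[OF linf_fun_const] by (simp add: Linf_alg_def)

lemma rep_one: "AE x in M. rep (\<one>\<^bsub>Linf_alg M\<^esub>) x = 1"
  using rep_linf_class(2)[OF linf_fun_const] by (simp add: Linf_alg_def)

context
  fixes M :: "'a measure" and F
  assumes F: "F \<in> carrier (Linf_alg M)"
begin

lemma Linf_add:
  assumes G: "G \<in> carrier (Linf_alg M)"
  shows "F \<oplus>\<^bsub>Linf_alg M\<^esub> G \<in> carrier (Linf_alg M)"
  "AE x in M. rep (F \<oplus>\<^bsub>Linf_alg M\<^esub> G) x = rep F x + rep G x"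
  using rep_linf_class(2)[OF linf_fun_add] linf_class_in_carrier[OF linf_fun_add]
    rep_in_linf_fun[OF F] rep_in_linf_fun[OF G]
  by (simp_all add: Linf_alg_def)

lemma Linf_mult:
  assumes G: "G \<in> carrier (Linf_alg M)"
  shows "F \<otimes>\<^bsub>Linf_alg M\<^esub> G \<in> carrier (Linf_alg M)"
  "AE x in M. rep (F \<otimes>\<^bsub>Linf_alg M\<^esub> G) x = rep F x * rep G x"
  using rep_linf_class(2)[OF linf_fun_mult] linf_class_in_carrier[OF linf_fun_mult]
    rep_in_linf_fun[OF F] rep_in_linf_fun[OF G]
  by (simp_all add: Linf_alg_def)

lemma Linf_star:
  "star (Linf_alg M) F \<in> carrier (Linf_alg M)"
  "AE x in M. rep (star (Linf_alg M) F) x = cnj (rep F x)"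
  using rep_linf_class(2)[OF linf_fun_cnj] linf_class_in_carrier[OF linf_fun_cnj]
    rep_in_linf_fun[OF F]
  by (simp_all add: Linf_alg_def)

lemma Linf_smult:
  "c \<odot>\<^bsub>Linf_alg M\<^esub> F \<in> carrier (Linf_alg M)"
  "AE x in M. rep (c \<odot>\<^bsub>Linf_alg M\<^esub> F) x = c * rep F x"
  using rep_linf_class(2)[OF linf_fun_mult[OF linf_fun_const]]
    linf_class_in_carrier[OF linf_fun_mult[OF linf_fun_const]] rep_in_linf_fun[OF F]
  by (simp_all add: Linf_alg_def)

end

lemma Linf_zero_one_closed:
  "\<zero>\<^bsub>Linf_alg M\<^esub> \<in> carrier (Linf_alg M)" "\<one>\<^bsub>Linf_alg M\<^esub> \<in> carrier (Linf_alg M)"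
  using linf_class_in_carrier[OF linf_fun_const] by (simp_all add: Linf_alg_def)

lemma abelian_monoid_Linf: "abelian_monoid (Linf_alg M)"
proof (rule abelian_monoidI)
  fix F G H
  assume F: "F \<in> carrier (Linf_alg M)" and G: "G \<in> carrier (Linf_alg M)"
  show "F \<oplus>\<^bsub>Linf_alg M\<^esub> G \<in> carrier (Linf_alg M)" using F G by (rule Linf_add)
  show "F \<oplus>\<^bsub>Linf_alg M\<^esub> G = G \<oplus>\<^bsub>Linf_alg M\<^esub> F"
    by (simp add: Linf_alg_def add.commute)
  show "\<zero>\<^bsub>Linf_alg M\<^esub> \<oplus>\<^bsub>Linf_alg M\<^esub> F = F"
  proof (rule Linf_eqI)
    show "AE x in M. rep (\<zero>\<^bsub>Linf_alg M\<^esub> \<oplus>\<^bsub>Linf_alg M\<^esub> F) x = rep F x"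
      using Linf_add(2)[OF Linf_zero_one_closed(1) F] rep_zero[of M] by eventually_elim simp
  qed (use F Linf_add(1)[OF Linf_zero_one_closed(1) F] in auto)
  assume H: "H \<in> carrier (Linf_alg M)"
  show "F \<oplus>\<^bsub>Linf_alg M\<^esub> G \<oplus>\<^bsub>Linf_alg M\<^esub> H = F \<oplus>\<^bsub>Linf_alg M\<^esub> (G \<oplus>\<^bsub>Linf_alg M\<^esub> H)"
  proof (rule Linf_eqI)
    show "AE x in M. rep (F \<oplus>\<^bsub>Linf_alg M\<^esub> G \<oplus>\<^bsub>Linf_alg M\<^esub> H) x =
        rep (F \<oplus>\<^bsub>Linf_alg M\<^esub> (G \<oplus>\<^bsub>Linf_alg M\<^esub> H)) x"
      using Linf_add(2)[OF Linf_add(1)[OF F G] H] Linf_add(2)[OF F Linf_add(1)[OF G H]]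
        Linf_add(2)[OF F G] Linf_add(2)[OF G H]
      by eventually_elim simp
  qed (intro Linf_add(1) F G H)+
qed (rule Linf_zero_one_closed)

lemma finsum_Linf:
  assumes "finite I" and "\<And>l. l \<in> I \<Longrightarrow> f l \<in> carrier (Linf_alg M)"
  shows "AE x in M. rep (finsum (Linf_alg M) f I) x = (\<Sum>l\<in>I. rep (f l) x)"
  using assms
proof (induction I)
  case empty
  interpret abelian_monoid "Linf_alg M" by (rule abelian_monoid_Linf)
  show ?case by (simp add: rep_zero)
next
  case (insert a I)
  interpret abelian_monoid "Linf_alg M" by (rule abelian_monoid_Linf)
  have "finsum (Linf_alg M) f (insert a I) = f a \<oplus>\<^bsub>Linf_alg M\<^esub> finsum (Linf_alg M) f I"
    using insert by (intro finsum_insert) auto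
  moreover have "AE x in M. rep (f a \<oplus>\<^bsub>Linf_alg M\<^esub> finsum (Linf_alg M) f I) x =
      rep (f a) x + rep (finsum (Linf_alg M) f I) x"
    using insert by (intro Linf_add finsum_closed) auto
  ultimately show ?case using insert by (auto elim: eventually_elim2)
qed

text \<open>
Only finitely many identities between representatives are involved, so their exceptional null
sets can be united.
\<close>

lemma positive_matrix_LinfD:
  assumes "positive_matrix (Linf_alg M) k P"
  obtains C where "\<And>i j. i < k \<Longrightarrow> j < k \<Longrightarrow> C i j \<in> linf_fun M"
    and "\<And>i j. i < k \<Longrightarrow> j < k \<Longrightarrow>
      AE x in M. rep (P i j) x = (\<Sum>l<k. cnj (C l i x) * C l j x)"
proof -
  obtain C where C: "\<And>i j. i < k \<Longrightarrow> j < k \<Longrightarrow> C i j \<in> carrier (Linf_alg M)"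
    and P: "\<And>i j. i < k \<Longrightarrow> j < k \<Longrightarrow>
      P i j = (\<Oplus>\<^bsub>Linf_alg M\<^esub>l\<in>{..<k}. star (Linf_alg M) (C l i) \<otimes>\<^bsub>Linf_alg M\<^esub> C l j)"
    using assms unfolding positive_matrix_def by blast
  have "AE x in M. rep (P i j) x = (\<Sum>l<k. cnj (rep (C l i) x) * rep (C l j) x)"
    if "i < k" "j < k" for i j
  proof -
    let ?t = "\<lambda>l. star (Linf_alg M) (C l i) \<otimes>\<^bsub>Linf_alg M\<^esub> C l j"
    have t: "?t l \<in> carrier (Linf_alg M)"
      "AE x in M. rep (?t l) x = cnj (rep (C l i) x) * rep (C l j) x" if "l < k" for l
    proof -
      note c = C[OF that \<open>i < k\<close>] C[OF that \<open>j < k\<close>]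
      show "?t l \<in> carrier (Linf_alg M)" by (intro Linf_mult Linf_star c)
      show "AE x in M. rep (?t l) x = cnj (rep (C l i) x) * rep (C l j) x"
        using Linf_mult(2)[OF Linf_star(1)[OF c(1)] c(2)] Linf_star(2)[OF c(1)]
        by eventually_elim simp
    qed
    have "AE x in M. rep (P i j) x = (\<Sum>l<k. rep (?t l) x)"
      unfolding P[OF that] by (rule finsum_Linf) (use t in auto)
    moreover have "AE x in M. \<forall>l\<in>{..<k}. rep (?t l) x = cnj (rep (C l i) x) * rep (C l j) x"
      by (rule AE_finite_allI) (use t in auto)
    ultimately show ?thesis by eventually_elim simp
  qed
  from that[of "\<lambda>i j. rep (C i j)", OF rep_in_linf_fun[OF C] this] show thesis by simp
qed

lemma linf_fun_sum:
  assumes "finite I" "\<And>i. i \<in> I \<Longrightarrow> f i \<in> linf_fun M"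
  shows "(\<lambda>x. \<Sum>i\<in>I. f i x) \<in> linf_fun M"
  using assms by (induction I) (simp_all add: linf_fun_const linf_fun_add)

lemma (in finite_measure) integrable_linf:
  assumes "f \<in> linf_fun M"
  shows "integrable M f"
proof -
  obtain c where "AE x in M. norm (f x) \<le> c" using assms by (auto simp: linf_fun_def)
  then show ?thesis using assms by (intro integrable_const_bound) (auto simp: linf_fun_def)
qed

section \<open>Positive semidefinite matrices\<close>

text \<open>
For an arbitrary finite index set instead of \<open>{..<k}\<close>, so that the factorisation can be built by
adding one index at a time.
\<close>

definition pos_semidef :: "'i set \<Rightarrow> ('i \<Rightarrow> 'i \<Rightarrow> complex) \<Rightarrow> bool" where
  "pos_semidef I P \<longleftrightarrow> (\<forall>i\<in>I. \<forall>j\<in>I. P j i = cnj (P i j)) \<and>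
     (\<forall>v. 0 \<le> Re (\<Sum>i\<in>I. \<Sum>j\<in>I. cnj (v i) * P i j * v j))"

lemma quadratic_form_insert:
  assumes "finite I" "a \<notin> I" and herm: "\<And>i. i \<in> I \<Longrightarrow> P i a = cnj (P a i)"
  shows "(\<Sum>i\<in>insert a I. \<Sum>j\<in>insert a I. cnj ((v(a := w)) i) * P i j * (v(a := w)) j) =
    cnj w * P a a * w + cnj w * (\<Sum>j\<in>I. P a j * v j) + cnj (\<Sum>j\<in>I. P a j * v j) * w +
    (\<Sum>i\<in>I. \<Sum>j\<in>I. cnj (v i) * P i j * v j)"
proof -
  have *: "(\<Sum>j\<in>insert a I. c * P i j * (v(a := w)) j) =
      c * P i a * w + c * (\<Sum>j\<in>I. P i j * v j)" for c i
  proof -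
    have "(\<Sum>j\<in>I. c * P i j * (v(a := w)) j) = c * (\<Sum>j\<in>I. P i j * v j)"
      unfolding sum_distrib_left using assms(2) by (intro sum.cong) auto
    then show ?thesis using assms by simp
  qed
  have "(\<Sum>i\<in>insert a I. \<Sum>j\<in>insert a I. cnj ((v(a := w)) i) * P i j * (v(a := w)) j) =
      (cnj w * P a a * w + cnj w * (\<Sum>j\<in>I. P a j * v j)) +
      (\<Sum>i\<in>I. cnj (v i) * P i a * w + cnj (v i) * (\<Sum>j\<in>I. P i j * v j))"
    unfolding * using assms by (simp add: fun_upd_def) (intro sum.cong, auto)
  also have "(\<Sum>i\<in>I. cnj (v i) * P i a * w + cnj (v i) * (\<Sum>j\<in>I. P i j * v j)) =
      cnj (\<Sum>j\<in>I. P a j * v j) * w + (\<Sum>i\<in>I. \<Sum>j\<in>I. cnj (v i) * P i j * v j)"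
    by (simp add: sum.distrib sum_distrib_left sum_distrib_right herm ac_simps)
  finally show ?thesis by (simp add: add.assoc)
qed

text \<open>
Cholesky factorisation by induction on the index set. Split off an index \<open>a\<close> with pivot
\<open>p = P a a\<close>; the quadratic form of the Schur complement \<open>P i j - P i a * P a j / p\<close> at \<open>v\<close> is that of
\<open>P\<close> at the extension of \<open>v\<close> that minimises it over the value at \<open>a\<close>, hence nonnegative. The
factorisation of the complement is completed by the row \<open>P a j / sqrt p\<close>. If \<open>p = 0\<close>, the whole
row \<open>P a\<close> vanishes, and with the convention \<open>x / 0 = 0\<close> the same formulas remain correct.
\<close>

lemma pos_semidef_factorisation:
  assumes "finite I" "pos_semidef I P"
  obtains C where "\<And>i j. i \<in> I \<Longrightarrow> j \<in> I \<Longrightarrow> P i j = (\<Sum>l\<in>I. cnj (C l i) * C l j)"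
proof -
  have "\<exists>C. \<forall>i\<in>I. \<forall>j\<in>I. P i j = (\<Sum>l\<in>I. cnj (C l i) * C l j)"
    using assms
  proof (induction I arbitrary: P)
    case (insert a I)
    have herm: "P j i = cnj (P i j)" if "i \<in> insert a I" "j \<in> insert a I" for i j
      using insert.prems that unfolding pos_semidef_def by blast
    define p where "p = Re (P a a)"
    have p: "P a a = of_real p"
      using herm[of a a] by (simp add: p_def complex_eq_iff)
    have Q: "0 \<le> Re (cnj w * P a a * w + cnj w * (\<Sum>j\<in>I. P a j * v j) +
        cnj (\<Sum>j\<in>I. P a j * v j) * w + (\<Sum>i\<in>I. \<Sum>j\<in>I. cnj (v i) * P i j * v j))" for v w
    proof -
      have h: "P i a = cnj (P a i)" if "i \<in> I" for i using herm[of a i] that by simp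
      have "0 \<le> Re (\<Sum>i\<in>insert a I. \<Sum>j\<in>insert a I. cnj ((v(a := w)) i) * P i j * (v(a := w)) j)"
        using insert.prems unfolding pos_semidef_def by blast
      then show ?thesis by (simp only: quadratic_form_insert[where P = P and v = v and w = w, OF insert.hyps(1,2) h])
    qed
    have "0 \<le> p" using Q[of 1 "\<lambda>_. 0"] by (simp add: p)
    have P0: "P a j = 0" if "p = 0" "j \<in> I" for j
    proof (rule ccontr)
      assume "P a j \<noteq> 0"
      \<comment> \<open>With entries \<open>- R * P a j\<close> at \<open>a\<close> and \<open>1\<close> at \<open>j\<close>, the form is negative for this \<open>R\<close>.\<close>
      define R where "R = (1 + \<bar>Re (P j j)\<bar>) / (cmod (P a j))\<^sup>2"
      have d: "(\<Sum>i\<in>I. f i * (if i = j then 1 else 0)) = f j" for f :: "_ \<Rightarrow> complex"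
        using insert.hyps \<open>j \<in> I\<close> by (simp add: if_distrib cong: if_cong)
      have d2: "(\<Sum>i\<in>I. \<Sum>k\<in>I. cnj (if i = j then 1 else 0) * P i k * (if k = j then 1 else 0)) = P j j"
        unfolding d by (rule trans[OF sum.cong[OF refl] d[of "\<lambda>i. P i j"]]) auto
      have "0 \<le> Re (P j j) - 2 * R * (cmod (P a j))\<^sup>2"
        using Q[of "- (of_real R * P a j)" "\<lambda>i. if i = j then 1 else 0"]
        unfolding d2 unfolding d p \<open>p = 0\<close> cmod_power2
        by (simp add: power2_eq_square algebra_simps)
      also have "\<dots> = Re (P j j) - 2 * (1 + \<bar>Re (P j j)\<bar>)"
        using \<open>P a j \<noteq> 0\<close> by (simp add: R_def)
      finally show False by argo
    qed
    define P' where "P' i j = P i j - P i a * P a j / of_real p" for i j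
    have "pos_semidef I P'"
      unfolding pos_semidef_def
    proof (intro conjI ballI allI)
      fix i j assume "i \<in> I" "j \<in> I"
      then show "P' j i = cnj (P' i j)"
        using herm[of i j] herm[of a i] herm[of a j] by (simp add: P'_def)
    next
      fix v
      define S where "S = (\<Sum>j\<in>I. P a j * v j)"
      have "(\<Sum>i\<in>I. \<Sum>j\<in>I. cnj (v i) * P' i j * v j) =
          (\<Sum>i\<in>I. \<Sum>j\<in>I. cnj (v i) * P i j * v j) -
          (\<Sum>i\<in>I. \<Sum>j\<in>I. (cnj (v i) * P i a) * (P a j * v j)) / of_real p"
        by (simp add: P'_def algebra_simps sum_subtractf sum_divide_distrib)
      also have "(\<Sum>i\<in>I. \<Sum>j\<in>I. (cnj (v i) * P i a) * (P a j * v j)) = cnj S * S"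
        using herm[of a] by (simp add: S_def flip: sum_product) (simp add: mult.commute)
      finally have eq: "(\<Sum>i\<in>I. \<Sum>j\<in>I. cnj (v i) * P' i j * v j) =
          (\<Sum>i\<in>I. \<Sum>j\<in>I. cnj (v i) * P i j * v j) - cnj S * S / of_real p" .
      show "0 \<le> Re (\<Sum>i\<in>I. \<Sum>j\<in>I. cnj (v i) * P' i j * v j)"
      proof -
        have "cnj w * P a a * w + cnj w * S + cnj S * w = - (cnj S * S / of_real p)"
          if "w = - S / of_real p" for w
          unfolding that p by (cases "p = 0") (simp_all add: field_simps)
        \<comment> \<open>The value at the pivot that minimises the quadratic form.\<close>
        from Q[of "- S / of_real p" v, folded S_def, unfolded this[OF refl]] show ?thesis
          unfolding eq by simp
      qed
    qed
    from insert.IH[OF this] obtain C where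
      C: "\<And>i j. i \<in> I \<Longrightarrow> j \<in> I \<Longrightarrow> P' i j = (\<Sum>l\<in>I. cnj (C l i) * C l j)" by blast
    define D where "D l j = (if l = a then P a j / of_real (sqrt p) else if j = a then 0 else C l j)" for l j
    have "P i j = (\<Sum>l\<in>insert a I. cnj (D l i) * D l j)"
      if i: "i \<in> insert a I" and j: "j \<in> insert a I" for i j
    proof -
      have "(\<Sum>l\<in>I. cnj (D l i) * D l j) = (if i = a \<or> j = a then 0 else P' i j)"
        using i j insert.hyps by (auto simp: D_def C intro!: sum.neutral sum.cong)
      moreover have "complex_of_real (sqrt p) * of_real (sqrt p) = of_real p"
        using \<open>0 \<le> p\<close> by (simp flip: of_real_mult)
      then have "cnj (D a i) * D a j = P i a * P a j / of_real p"
        using herm[of a i] i by (simp add: D_def)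
      moreover have "P i j = P i a * P a j / of_real p" if "i = a \<or> j = a"
      proof (cases "p = 0")
        case True
        then have "P a i = 0" "P a j = 0" using P0 p i j by auto
        then show ?thesis using that herm[of a i] i by auto
      next
        case False
        then show ?thesis using that p by auto
      qed
      ultimately show ?thesis using insert.hyps by (auto simp: P'_def)
    qed
    then show ?case by blast
  qed simp
  then show thesis using that by blast
qed

lemma pos_semidef_scale:
  assumes "pos_semidef I P" "0 \<le> c"
  shows "pos_semidef I (\<lambda>i j. of_real c * P i j)"
  unfolding pos_semidef_def
proof (intro conjI ballI allI)
  fix i j assume "i \<in> I" "j \<in> I"
  then have "P j i = cnj (P i j)" using assms(1) unfolding pos_semidef_def by blast
  then show "of_real c * P j i = cnj (of_real c * P i j)" by simp
next
  fix v
  let ?q = "\<Sum>i\<in>I. \<Sum>j\<in>I. cnj (v i) * P i j * v j"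
  have "(\<Sum>i\<in>I. \<Sum>j\<in>I. cnj (v i) * (of_real c * P i j) * v j) = of_real c * ?q"
    by (simp add: sum_distrib_left ac_simps)
  moreover have "0 \<le> Re ?q" using assms(1) unfolding pos_semidef_def by blast
  ultimately show "0 \<le> Re (\<Sum>i\<in>I. \<Sum>j\<in>I. cnj (v i) * (of_real c * P i j) * v j)"
    using assms(2) by simp
qed

lemma pos_semidef_cong:
  assumes eq: "\<And>i j. i \<in> I \<Longrightarrow> j \<in> I \<Longrightarrow> P i j = Q i j" and Q: "pos_semidef I Q"
  shows "pos_semidef I P"
  unfolding pos_semidef_def
proof (intro conjI ballI allI)
  fix i j assume "i \<in> I" "j \<in> I"
  moreover from this have "Q j i = cnj (Q i j)" using Q unfolding pos_semidef_def by blast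
  ultimately show "P j i = cnj (P i j)" by (simp only: eq)
next
  fix v
  have "(\<Sum>i\<in>I. \<Sum>j\<in>I. cnj (v i) * P i j * v j) = (\<Sum>i\<in>I. \<Sum>j\<in>I. cnj (v i) * Q i j * v j)"
    by (intro sum.cong refl) (simp only: eq)
  then show "0 \<le> Re (\<Sum>i\<in>I. \<Sum>j\<in>I. cnj (v i) * P i j * v j)"
    using Q unfolding pos_semidef_def by presburger
qed

section \<open>Cylinders\<close>

lemma restrict_in_level: "\<omega> \<in> Omega d \<Longrightarrow> restrict \<omega> {..<n} \<in> level d n"
  by (auto simp: Omega_def level_def)

lemma space_mu: "space (mu d) = Omega d"
  by (simp add: mu_def Omega_def space_PiM space_uniform_count_measure)

text \<open>
As a box, a cylinder is visibly open and its measure is a finite product.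
\<close>

lemma cyl_eq_PiE:
  assumes "x \<in> level d n"
  shows "cyl d n x = (\<Pi>\<^sub>E i\<in>UNIV. if i < n then {x i} else {1..d i})" (is "_ = ?R")
proof -
  have x: "x \<in> extensional {..<n}" "\<And>i. i < n \<Longrightarrow> x i \<in> {1..d i}"
    using assms by (auto simp only: level_def PiE_iff lessThan_iff)
  have r: "restrict \<omega> {..<n} = x \<longleftrightarrow> (\<forall>i<n. \<omega> i = x i)" for \<omega>
    using x(1) extensionalityI[of "restrict \<omega> {..<n}" "{..<n}" x] by auto
  have "\<omega> \<in> cyl d n x \<longleftrightarrow> (\<forall>i. \<omega> i \<in> (if i < n then {x i} else {1..d i}))" for \<omega>
    unfolding cyl_def Omega_def mem_Collect_eq r PiE_UNIV_domain Pi_iff using x(2) by force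
  then show ?thesis by (simp only: set_eq_iff PiE_UNIV_domain Pi_iff) blast
qed

lemma measure_cyl:
  assumes d: "inductive_family d" and x: "x \<in> level d n"
  shows "measure (mu d) (cyl d n x) = 1 / card (level d n)"
proof -
  have x_mem: "x i \<in> {1..d i}" if "i < n" for i
    using x that by (auto simp only: level_def PiE_iff lessThan_iff)
  have d1: "{1..d i} \<noteq> {}" for i using d by (auto simp: inductive_family_def)
  interpret product_prob_space "\<lambda>i. uniform_count_measure {1..d i}" UNIV
    by (intro product_prob_spaceI prob_space_uniform_count_measure) (use d1 in auto)
  have "cyl d n x = prod_emb UNIV (\<lambda>i. uniform_count_measure {1..d i}) {..<n} (\<Pi>\<^sub>E i\<in>{..<n}. {x i})"
    unfolding cyl_eq_PiE[OF x] using x_mem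
    by (subst prod_emb_PiE) (auto simp: space_uniform_count_measure intro!: PiE_cong)
  also have "measure (mu d) \<dots> = (\<Prod>i<n. measure (uniform_count_measure {1..d i}) {x i})"
    unfolding mu_def
    by (rule measure_PiM_emb) (use x_mem in \<open>auto simp: sets_uniform_count_measure\<close>)
  also have "\<dots> = (\<Prod>i<n. 1 / d i)"
    using x_mem by (intro prod.cong refl, subst measure_uniform_count_measure) auto
  also have "\<dots> = 1 / card (level d n)"
    by (simp add: level_def card_PiE prod_dividef)
  finally show ?thesis .
qed

lemma UN_cyl: "(\<Union>x\<in>level d n. cyl d n x) = Omega d"
  using restrict_in_level by (fastforce simp: cyl_def)

text \<open>
Two cylinders are nested or disjoint.
\<close>

lemma cyl_subset_cyl:
  assumes "\<omega> \<in> cyl d m x" "\<omega> \<in> cyl d m' x'" "m \<le> m'"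
  shows "cyl d m' x' \<subseteq> cyl d m x"
proof
  fix u assume u: "u \<in> cyl d m' x'"
  have "restrict v {..<m} = restrict (restrict v {..<m'}) {..<m}" for v :: "nat \<Rightarrow> nat"
    using assms(3) by (auto simp: fun_eq_iff)
  from this[of u] this[of \<omega>] show "u \<in> cyl d m x"
    using u assms(1,2) by (simp add: cyl_def del: restrict_restrict)
qed

lemma C_alg_carrierI:
  "continuous_map T euclidean f \<Longrightarrow> (\<lambda>x\<in>topspace T. f x) \<in> carrier (C_alg T)"
  by (simp add: C_alg_def continuous_map_restrict)

lemma C_alg_continuous: "f \<in> carrier (C_alg T) \<Longrightarrow> continuous_map T euclidean f"
  by (simp add: C_alg_def)

lemma topspace_Omega_top [simp]: "topspace (Omega_top d) = Omega d"
  by (simp add: Omega_top_def Omega_def)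

lemma openin_cyl: "openin (Omega_top d) (cyl d n x)"
proof (cases "x \<in> level d n")
  case True
  have "finite {i. (if i < n then {x i} else {1..d i}) \<noteq> {1..d i}}"
    by (rule finite_subset[of _ "{..<n}"]) auto
  moreover have "x i \<in> {1..d i}" if "i < n" for i
    using True that by (auto simp only: level_def PiE_iff lessThan_iff)
  ultimately show ?thesis
    unfolding cyl_eq_PiE[OF True] Omega_top_def by (subst openin_PiE_gen) auto
next
  case False
  then have "cyl d n x = {}" using restrict_in_level[of _ d n] by (auto simp: cyl_def)
  then show ?thesis by simp
qed

lemma sum_indicator_cyl:
  fixes c :: "_ \<Rightarrow> complex"
  assumes "finite A" "\<And>a. a \<in> A \<Longrightarrow> \<omega> \<in> S a \<longleftrightarrow> a = b" "b \<in> A"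
  shows "(\<Sum>a\<in>A. c a * indicator (S a) \<omega>) = c b"
proof -
  have "(\<Sum>a\<in>A. c a * indicator (S a) \<omega>) = (\<Sum>a\<in>A. if b = a then c a else 0)"
    using assms(2) by (intro sum.cong refl) (auto simp: indicator_def)
  then show ?thesis using assms by simp
qed

text \<open>
At each point exactly one summand of the defining sum is nonzero.
\<close>

lemma cyl_embed_eq: "cyl_embed d n \<phi> = (\<lambda>\<omega>\<in>Omega d. \<phi> (restrict \<omega> {..<n}))"
  unfolding cyl_embed_def
  by (intro restrict_ext sum_indicator_cyl) (auto simp: finite_level cyl_def restrict_in_level)

lemma cyl_embed2_eq:
  "cyl_embed2 dA dB n \<phi> =
   (\<lambda>\<omega>\<in>Omega dA \<times> Omega dB. \<phi> (restrict (fst \<omega>) {..<n}, restrict (snd \<omega>) {..<n}))"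
  unfolding cyl_embed2_def case_prod_unfold prod.collapse
  by (intro restrict_ext sum_indicator_cyl) (auto simp: finite_level cyl_def restrict_in_level)

lemma continuous_map_locally_constant:
  assumes "\<And>x. x \<in> topspace T \<Longrightarrow> \<exists>U. openin T U \<and> x \<in> U \<and> (\<forall>y\<in>U. f y = f x)"
  shows "continuous_map T euclidean f"
  unfolding continuous_map_def
proof (intro conjI allI impI)
  fix V
  show "openin T {x \<in> topspace T. f x \<in> V}"
  proof (subst openin_subopen, intro ballI)
    fix x assume x: "x \<in> {x \<in> topspace T. f x \<in> V}"
    then obtain U where U: "openin T U" "x \<in> U" "\<forall>y\<in>U. f y = f x" using assms by blast
    have "y \<in> {x \<in> topspace T. f x \<in> V}" if "y \<in> U" for y
    proof -
      have "f y = f x" using U(3) that by blast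
      then show ?thesis using x that openin_subset[OF U(1)] by auto
    qed
    then have "U \<subseteq> {x \<in> topspace T. f x \<in> V}" by blast
    then show "\<exists>U. openin T U \<and> x \<in> U \<and> U \<subseteq> {x \<in> topspace T. f x \<in> V}" using U by blast
  qed
qed simp

lemma cyl_embed_continuous: "cyl_embed d n \<phi> \<in> carrier (C_alg (Omega_top d))"
proof -
  have "continuous_map (Omega_top d) euclidean (cyl_embed d n \<phi>)"
  proof (rule continuous_map_locally_constant)
    fix \<omega> assume "\<omega> \<in> topspace (Omega_top d)"
    then show "\<exists>U. openin (Omega_top d) U \<and> \<omega> \<in> U \<and> (\<forall>u\<in>U. cyl_embed d n \<phi> u = cyl_embed d n \<phi> \<omega>)"
      by (intro exI[of _ "cyl d n (restrict \<omega> {..<n})"] conjI openin_cyl)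
        (auto simp: cyl_def cyl_embed_eq)
  qed
  then show ?thesis by (simp add: C_alg_def) (simp add: cyl_embed_def)
qed

lemma cyl_embed2_continuous: "cyl_embed2 dA dB n \<phi> \<in> carrier (C_tensor_alg dA dB)"
proof -
  let ?T = "prod_topology (Omega_top dA) (Omega_top dB)"
  have "continuous_map ?T euclidean (cyl_embed2 dA dB n \<phi>)"
  proof (rule continuous_map_locally_constant)
    fix w assume "w \<in> topspace ?T"
    then show "\<exists>U. openin ?T U \<and> w \<in> U \<and> (\<forall>u\<in>U. cyl_embed2 dA dB n \<phi> u = cyl_embed2 dA dB n \<phi> w)"
      by (intro exI[of _ "cyl dA n (restrict (fst w) {..<n}) \<times> cyl dB n (restrict (snd w) {..<n})"]
          conjI) (auto simp: cyl_def cyl_embed2_eq openin_prod_Times_iff openin_cyl[unfolded cyl_def])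
  qed
  then show ?thesis by (simp add: C_alg_def) (simp add: cyl_embed2_def)
qed

text \<open>
A function of the first \<open>k\<close> coordinates is also a function of the first \<open>m\<close>. This lets the
hypotheses on all \<open>\<Gamma>\<^sub>m\<close> with \<open>m \<ge> k\<close> be applied to one fixed function.
\<close>

lemma cyl_embed_refine:
  assumes "k \<le> m"
  shows "\<exists>\<phi>'\<in>extensional (level d m). cyl_embed d m \<phi>' = cyl_embed d k \<phi>"
proof
  have "restrict (restrict \<omega> {..<m}) {..<k} = restrict \<omega> {..<k}" for \<omega> :: "nat \<Rightarrow> nat"
    using assms by (auto simp: fun_eq_iff)
  then show "cyl_embed d m (\<lambda>a\<in>level d m. \<phi> (restrict a {..<k})) = cyl_embed d k \<phi>"
    unfolding cyl_embed_eq by (intro restrict_ext) (simp add: restrict_in_level del: restrict_restrict)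
qed simp

lemma cyl_embed_one: "cyl_embed d n (\<lambda>a\<in>level d n. 1) = \<one>\<^bsub>C_alg (Omega_top d)\<^esub>"
  by (auto simp: cyl_embed_eq C_alg_def restrict_in_level)

lemma compact_Omega_top: "compact_space (Omega_top d)"
  unfolding Omega_top_def compact_space_product_topology
  by (auto simp: compact_space_discrete_topology)

lemma cyl_neighbourhood_base:
  assumes "openin (Omega_top d) U" "\<omega> \<in> U"
  obtains n where "cyl d n (restrict \<omega> {..<n}) \<subseteq> U"
proof -
  obtain V where fin: "finite {i. V i \<noteq> {1..d i}}" and V: "\<omega> \<in> Pi\<^sub>E UNIV V" "Pi\<^sub>E UNIV V \<subseteq> U"
    using assms unfolding Omega_top_def openin_product_topology_alt by auto
  obtain n where n: "\<And>i. V i \<noteq> {1..d i} \<Longrightarrow> i < n"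
    using finite_nat_set_iff_bounded[of "{i. V i \<noteq> {1..d i}}"] fin by auto
  have "cyl d n (restrict \<omega> {..<n}) \<subseteq> Pi\<^sub>E UNIV V"
  proof
    fix u assume u: "u \<in> cyl d n (restrict \<omega> {..<n})"
    have "u i \<in> V i" for i
    proof (cases "i < n")
      case True
      have "restrict u {..<n} i = restrict \<omega> {..<n} i" using u by (simp add: cyl_def)
      with True have "u i = \<omega> i" by simp
      then show ?thesis using V(1) by auto
    next
      case False
      have "u i \<in> {1..d i}" using u by (auto simp only: cyl_def Omega_def PiE_UNIV_domain Pi_iff mem_Collect_eq)
      then show ?thesis using n False by blast
    qed
    then show "u \<in> Pi\<^sub>E UNIV V" by auto
  qed
  then show thesis using that V(2) by blast
qed

text \<open>
The cylinders on which \<open>f\<close> oscillates by at most \<open>e\<close> cover the compact space \<open>Omega d\<close>. If \<open>k\<close> bounds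
the levels in a finite subcover, \<open>f\<close> oscillates by at most \<open>e\<close> on every cylinder of level \<open>k\<close>, so it
may be replaced there by its value at one point.
\<close>

lemma cyl_embed_dense:
  assumes d: "inductive_family d" and f: "continuous_map (Omega_top d) euclidean f" and "e > 0"
  obtains k \<phi> where "\<And>\<omega>. \<omega> \<in> Omega d \<Longrightarrow> norm (f \<omega> - cyl_embed d k \<phi> \<omega> :: complex) \<le> e"
proof -
  define \<U> where "\<U> = {cyl d n x |n x. \<forall>u\<in>cyl d n x. \<forall>v\<in>cyl d n x. norm (f u - f v) \<le> e}"
  have cover: "\<omega> \<in> \<Union>\<U>" if "\<omega> \<in> Omega d" for \<omega>
  proof -
    have "openin (Omega_top d) {u \<in> Omega d. f u \<in> ball (f \<omega>) (e / 2)}"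
      using f open_ball unfolding continuous_map_def topspace_Omega_top open_openin[symmetric]
      by blast
    moreover have "\<omega> \<in> {u \<in> Omega d. f u \<in> ball (f \<omega>) (e / 2)}" using that \<open>e > 0\<close> by simp
    ultimately obtain n where n: "cyl d n (restrict \<omega> {..<n}) \<subseteq> {u \<in> Omega d. f u \<in> ball (f \<omega>) (e / 2)}"
      by (rule cyl_neighbourhood_base)
    have "norm (f u - f v) \<le> e"
      if "u \<in> cyl d n (restrict \<omega> {..<n})" "v \<in> cyl d n (restrict \<omega> {..<n})" for u v
      using n that dist_triangle_half_r[of "f \<omega>" "f u" e "f v"] by (auto simp: dist_norm subset_iff)
    moreover have "\<omega> \<in> cyl d n (restrict \<omega> {..<n})" using that by (simp add: cyl_def)
    ultimately show ?thesis unfolding \<U>_def by blast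
  qed
  have "\<exists>\<F>. finite \<F> \<and> \<F> \<subseteq> \<U> \<and> Omega d \<subseteq> \<Union>\<F>"
    using compact_Omega_top[of d] cover openin_cyl
    unfolding compact_space_alt topspace_Omega_top
    by (elim allE[of _ \<U>] impE) (auto simp: \<U>_def)
  then obtain \<F> where \<F>: "finite \<F>" "\<F> \<subseteq> \<U>" "Omega d \<subseteq> \<Union>\<F>" by blast
  have "\<exists>n. \<exists>x. V = cyl d n x" if "V \<in> \<F>" for V
    using subsetD[OF \<F>(2) that] unfolding \<U>_def by blast
  then obtain N where N: "\<And>V. V \<in> \<F> \<Longrightarrow> \<exists>x. V = cyl d (N V) x" by metis
  define k where "k = Max (insert 0 (N ` \<F>))"
  have k: "N V \<le> k" if "V \<in> \<F>" for V using \<F>(1) that by (simp add: k_def)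
  have osc: "norm (f u - f v) \<le> e"
    if u: "u \<in> Omega d" and v: "v \<in> Omega d" and uv: "restrict u {..<k} = restrict v {..<k}" for u v
  proof -
    obtain V where V: "V \<in> \<F>" "u \<in> V" using \<F>(3) u by auto
    then obtain x where x: "V = cyl d (N V) x" using N by blast
    have "cyl d k (restrict u {..<k}) \<subseteq> cyl d (N V) x"
      by (rule cyl_subset_cyl[of u]) (use V x u k in \<open>auto simp: cyl_def\<close>)
    then have "v \<in> V" using x v uv by (auto simp: cyl_def)
    moreover have "\<forall>u\<in>V. \<forall>v\<in>V. norm (f u - f v) \<le> e" using \<F>(2) V(1) by (auto simp: \<U>_def)
    ultimately show ?thesis using V(2) by blast
  qed
  \<comment> \<open>The constant \<open>1\<close> is an admissible symbol at every position.\<close>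
  define ext where "ext a i = (if i < k then a i else 1)" for a :: "nat \<Rightarrow> nat" and i
  have "norm (f \<omega> - cyl_embed d k (\<lambda>a. f (ext a)) \<omega>) \<le> e" if w: "\<omega> \<in> Omega d" for \<omega>
  proof -
    have "ext (restrict \<omega> {..<k}) \<in> Omega d"
      using w d by (auto simp: ext_def Omega_def inductive_family_def PiE_iff)
    then show ?thesis
      unfolding cyl_embed_eq using w by (simp, intro osc) (auto simp: ext_def fun_eq_iff)
  qed
  then show thesis by (rule that)
qed

section \<open>Integrals over rectangles of cylinders\<close>

text \<open>
The empty set makes the family stable under intersections. The lower bound \<open>k\<close> on the levels
is kept because the identities between integrals are known only from some level on.
\<close>

definition cyl_rects :: "(nat \<Rightarrow> nat) \<Rightarrow> (nat \<Rightarrow> nat) \<Rightarrow> nat \<Rightarrow> ((nat \<Rightarrow> nat) \<times> (nat \<Rightarrow> nat)) set set" where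
  "cyl_rects dX dY k = insert {} {cyl dX m x \<times> cyl dY m y |m x y.
     k \<le> m \<and> x \<in> level dX m \<and> y \<in> level dY m}"

lemma Int_stable_cyl_rects: "Int_stable (cyl_rects dX dY k)"
proof -
  have *: "R \<inter> R' \<in> cyl_rects dX dY k"
    if R: "R = cyl dX m x \<times> cyl dY m y" and R': "R' = cyl dX m' x' \<times> cyl dY m' y'"
      and "R' \<in> cyl_rects dX dY k" "m \<le> m'" for R R' m x y m' x' y'
  proof (cases "R \<inter> R' = {}")
    case False
    then obtain u v where "(u, v) \<in> R" "(u, v) \<in> R'" by auto
    then have "R' \<subseteq> R"
      unfolding R R' using cyl_subset_cyl[of u dX m x m' x'] cyl_subset_cyl[of v dY m y m' y'] that
      by auto
    then show ?thesis using that by (simp add: Int_absorb1)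
  qed (simp add: cyl_rects_def)
  show ?thesis
  proof (rule Int_stableI)
    fix R R' assume RR: "R \<in> cyl_rects dX dY k" "R' \<in> cyl_rects dX dY k"
    show "R \<inter> R' \<in> cyl_rects dX dY k"
    proof (cases "R = {} \<or> R' = {}")
      case False
      with RR obtain m x y m' x' y' where
        "R = cyl dX m x \<times> cyl dY m y" "R' = cyl dX m' x' \<times> cyl dY m' y'"
        unfolding cyl_rects_def by blast
      then show ?thesis
        using *[of R m x y R' m' x' y'] *[of R' m' x' y' R m x y] RR
        by (metis Int_commute nat_le_linear)
    qed (auto simp: cyl_rects_def)
  qed
qed

text \<open>
An event on the coordinate \<open>i\<close> of either factor is a finite union of rectangles of
any level above \<open>i\<close>, so all coordinates are measurable for the generated \<open>\<sigma>\<close>-algebra.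
\<close>

lemma sets_pair_mu:
  "sets (mu dX \<Otimes>\<^sub>M mu dY) \<subseteq> sigma_sets (Omega dX \<times> Omega dY) (cyl_rects dX dY k)"
proof -
  define N where "N = sigma (Omega dX \<times> Omega dY) (cyl_rects dX dY k)"
  have E: "cyl_rects dX dY k \<subseteq> Pow (Omega dX \<times> Omega dY)"
    by (auto simp: cyl_rects_def cyl_def)
  have sN: "space N = Omega dX \<times> Omega dY" "sets N = sigma_sets (Omega dX \<times> Omega dY) (cyl_rects dX dY k)"
    using E by (auto simp: N_def)
  have *: "{w \<in> Omega dX \<times> Omega dY. P (restrict (fst w) {..<m}) (restrict (snd w) {..<m})} \<in> sets N"
    if "k \<le> m" for P m
  proof -
    have "{w \<in> Omega dX \<times> Omega dY. P (restrict (fst w) {..<m}) (restrict (snd w) {..<m})} =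
        (\<Union>(x, y)\<in>{(x, y)\<in>level dX m \<times> level dY m. P x y}. cyl dX m x \<times> cyl dY m y)"
      using restrict_in_level by (fastforce simp: cyl_def)
    also have "\<dots> \<in> sets N"
    proof (rule sets.finite_UN)
      show "finite {(x, y)\<in>level dX m \<times> level dY m. P x y}"
        by (rule finite_subset[of _ "level dX m \<times> level dY m"]) (auto simp: finite_level)
    qed (use that in \<open>auto simp: sN cyl_rects_def intro!: sigma_sets.Basic\<close>)
    finally show ?thesis .
  qed
  have cX: "(\<lambda>w. fst w i) \<in> N \<rightarrow>\<^sub>M uniform_count_measure {1..dX i}"
    and cY: "(\<lambda>w. snd w i) \<in> N \<rightarrow>\<^sub>M uniform_count_measure {1..dY i}" for i
  proof -
    let ?m = "max k (Suc i)"
    have "(\<lambda>w. fst w i) -` {a} \<inter> space N =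
        {w \<in> Omega dX \<times> Omega dY. restrict (fst w) {..<?m} i = a}"
      "(\<lambda>w. snd w i) -` {a} \<inter> space N =
        {w \<in> Omega dX \<times> Omega dY. restrict (snd w) {..<?m} i = a}" for a
      by (auto simp: sN less_max_iff_disj)
    then have "(\<lambda>w. fst w i) -` {a} \<inter> space N \<in> sets N" "(\<lambda>w. snd w i) -` {a} \<inter> space N \<in> sets N" for a
      using *[OF max.cobounded1, of "\<lambda>x y. x i = a" "Suc i"]
        *[OF max.cobounded1, of "\<lambda>x y. y i = a" "Suc i"] by (simp_all only:)
    then show "(\<lambda>w. fst w i) \<in> N \<rightarrow>\<^sub>M uniform_count_measure {1..dX i}"
      "(\<lambda>w. snd w i) \<in> N \<rightarrow>\<^sub>M uniform_count_measure {1..dY i}"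
      by (auto simp: measurable_count_space_eq2 sN Omega_def PiE_iff
          measurable_cong_sets[OF refl sets_uniform_count_measure_count_space])
  qed
  have "(\<lambda>w. fst w) \<in> N \<rightarrow>\<^sub>M mu dX"
    using measurable_PiM_single'[of UNIV "\<lambda>i w. fst w i", OF cX]
    by (simp add: mu_def sN Omega_def space_uniform_count_measure PiE_iff Pi_iff)
  moreover have "(\<lambda>w. snd w) \<in> N \<rightarrow>\<^sub>M mu dY"
    using measurable_PiM_single'[of UNIV "\<lambda>i w. snd w i", OF cY]
    by (simp add: mu_def sN Omega_def space_uniform_count_measure PiE_iff Pi_iff)
  ultimately have id: "(\<lambda>w. w) \<in> N \<rightarrow>\<^sub>M mu dX \<Otimes>\<^sub>M mu dY"
    by (simp add: measurable_pair_iff comp_def)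
  show ?thesis
  proof
    fix S assume S: "S \<in> sets (mu dX \<Otimes>\<^sub>M mu dY)"
    then have "S \<subseteq> Omega dX \<times> Omega dY"
      using sets.sets_into_space[OF S] by (simp add: space_pair_measure space_mu)
    then show "S \<in> sigma_sets (Omega dX \<times> Omega dY) (cyl_rects dX dY k)"
      using measurable_sets[OF id S] by (simp add: sN Int_absorb2)
  qed
qed

text \<open>
For a real function \<open>r\<close>, the choice \<open>S = {r > 0}\<close> forces the positive part of \<open>r\<close> to vanish almost
everywhere; this is applied to the real and imaginary parts of \<open>f\<close> and to their negatives.
\<close>

lemma AE_zero_if_set_integrals_zero:
  fixes f :: "'a \<Rightarrow> complex"
  assumes f: "integrable M f" and null: "\<And>S. S \<in> sets M \<Longrightarrow> (LINT x:S|M. f x) = 0"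
  shows "AE x in M. f x = 0"
proof -
  have real: "AE x in M. r x \<le> 0"
    if r: "integrable M r" and z: "\<And>S. S \<in> sets M \<Longrightarrow> (LINT x:S|M. r x) = 0" for r :: "'a \<Rightarrow> real"
  proof -
    have [measurable]: "r \<in> borel_measurable M" using r by simp
    define S where "S = {x \<in> space M. 0 < r x}"
    have S: "S \<in> sets M" by (simp add: S_def)
    have "AE x in M. indicator S x *\<^sub>R r x = 0"
    proof (subst integral_nonneg_eq_0_iff_AE[symmetric])
      show "integrable M (\<lambda>x. indicator S x *\<^sub>R r x)"
        using r S by (rule integrable_mult_indicator[rotated])
      show "AE x in M. 0 \<le> indicator S x *\<^sub>R r x" by (auto simp: S_def indicator_def)
      show "(LINT x|M. indicator S x *\<^sub>R r x) = 0"
        using z[OF S] by (simp add: set_lebesgue_integral_def)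
    qed
    then show ?thesis
      using AE_space by eventually_elim (auto simp: S_def indicator_def split: if_splits)
  qed
  have int: "set_integrable M S f" if "S \<in> sets M" for S
    using f that unfolding set_integrable_def by (rule integrable_mult_indicator[rotated])
  have lin: "(LINT x:S|M. T (f x)) = 0" if "S \<in> sets M" "bounded_linear T" for T :: "complex \<Rightarrow> real" and S
  proof -
    interpret bounded_linear T by fact
    have "(LINT x:S|M. T (f x)) = T (LINT x:S|M. f x)"
      using integral_bounded_linear[OF that(2) int[OF that(1), unfolded set_integrable_def]]
      by (simp add: set_lebesgue_integral_def scaleR)
    then show ?thesis by (simp add: null that zero)
  qed
  have "AE x in M. T (f x) \<le> 0" if "bounded_linear T" for T :: "complex \<Rightarrow> real"
    by (rule real) (use f that lin in \<open>auto intro: integrable_bounded_linear\<close>)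
  from this[OF bounded_linear_Re] this[OF bounded_linear_Im]
    this[OF bounded_linear_minus[OF bounded_linear_Re]]
    this[OF bounded_linear_minus[OF bounded_linear_Im]]
  show ?thesis by eventually_elim (auto simp: complex_eq_iff)
qed

lemma pair_prob_space_mu:
  assumes "inductive_family dX" "inductive_family dY"
  shows "pair_prob_space (mu dX) (mu dY)"
proof -
  interpret X: prob_space "mu dX" using assms(1) by (rule prob_space_mu)
  interpret Y: prob_space "mu dY" using assms(2) by (rule prob_space_mu)
  show ?thesis ..
qed

lemma sets_cyl_times: "cyl dX m x \<times> cyl dY m y \<in> sets (mu dX \<Otimes>\<^sub>M mu dY)"
  by (intro pair_measureI sets_cyl)

text \<open>
The sets over which the difference integrates to zero form a Dynkin system: the total space
belongs to it as a finite disjoint union of rectangles of level \<open>k\<close>. It contains the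
intersection-stable generator, hence every measurable set.
\<close>

lemma AE_eq_if_cyl_integrals_eq:
  fixes f g :: "(nat \<Rightarrow> nat) \<times> (nat \<Rightarrow> nat) \<Rightarrow> complex"
  assumes f: "integrable (mu dX \<Otimes>\<^sub>M mu dY) f" and g: "integrable (mu dX \<Otimes>\<^sub>M mu dY) g"
    and eq: "\<And>m x y. k \<le> m \<Longrightarrow> x \<in> level dX m \<Longrightarrow> y \<in> level dY m \<Longrightarrow>
      (LINT w:cyl dX m x \<times> cyl dY m y|mu dX \<Otimes>\<^sub>M mu dY. f w) =
      (LINT w:cyl dX m x \<times> cyl dY m y|mu dX \<Otimes>\<^sub>M mu dY. g w)"
  shows "AE w in mu dX \<Otimes>\<^sub>M mu dY. f w = g w"
proof -
  let ?M = "mu dX \<Otimes>\<^sub>M mu dY" and ?\<Omega> = "Omega dX \<times> Omega dY"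
  let ?h = "\<lambda>w. f w - g w"
  have sp: "space ?M = ?\<Omega>" by (simp add: space_pair_measure space_mu)
  have h: "set_integrable ?M S ?h" if "S \<in> sets ?M" for S
    unfolding set_integrable_def using that f g by (intro integrable_mult_indicator) auto
  have rect: "(LINT w:cyl dX m x \<times> cyl dY m y|?M. ?h w) = 0"
    if "k \<le> m" "x \<in> level dX m" "y \<in> level dY m" for m x y
  proof (subst set_integral_diff)
    show "set_integrable ?M (cyl dX m x \<times> cyl dY m y) f"
      "set_integrable ?M (cyl dX m x \<times> cyl dY m y) g"
      unfolding set_integrable_def using f g sets_cyl_times
      by (auto intro!: integrable_mult_indicator)
  qed (use eq that in auto)
  have total: "(LINT w:?\<Omega>|?M. ?h w) = 0"
  proof -
    have U: "?\<Omega> = (\<Union>p\<in>level dX k \<times> level dY k. cyl dX k (fst p) \<times> cyl dY k (snd p))"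
      unfolding UN_cyl[of dX k, symmetric] UN_cyl[of dY k, symmetric] by auto
    have "(LINT w:?\<Omega>|?M. ?h w) =
        (\<Sum>p\<in>level dX k \<times> level dY k. LINT w:cyl dX k (fst p) \<times> cyl dY k (snd p)|?M. ?h w)"
      unfolding U
    proof (rule set_integral_finite_Union[where A = "\<lambda>p. cyl dX k (fst p) \<times> cyl dY k (snd p)"])
      show "disjoint_family_on (\<lambda>p. cyl dX k (fst p) \<times> cyl dY k (snd p)) (level dX k \<times> level dY k)"
        by (auto simp: disjoint_family_on_def cyl_def)
    qed (auto simp: finite_level sets_cyl_times h)
    also have "\<dots> = 0" using rect by (intro sum.neutral) auto
    finally show ?thesis .
  qed
  have "(LINT w:S|?M. ?h w) = 0" if "S \<in> sets ?M" for S
  proof -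
    have G: "cyl_rects dX dY k \<subseteq> Pow ?\<Omega>" "cyl_rects dX dY k \<subseteq> sets ?M"
      using sets_cyl_times by (auto simp: cyl_rects_def cyl_def)
    have sig: "T \<in> sets ?M" if "T \<in> sigma_sets ?\<Omega> (cyl_rects dX dY k)" for T
      using sets.sigma_sets_subset[OF G(2)] that sp by auto
    have "S \<in> sigma_sets ?\<Omega> (cyl_rects dX dY k)" using that sets_pair_mu by auto
    with Int_stable_cyl_rects G(1) show ?thesis
    proof (induction rule: sigma_sets_induct_disjoint)
      case (basic S)
      then show ?case using rect by (auto simp: cyl_rects_def set_lebesgue_integral_def)
    next
      case empty
      show ?case by (simp add: set_lebesgue_integral_def)
    next
      case (compl S)
      have "S \<subseteq> ?\<Omega>" using compl(1) sigma_sets_into_sp[OF G(1)] by auto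
      then have "?\<Omega> = S \<union> (?\<Omega> - S)" by auto
      moreover have "(LINT w:S \<union> (?\<Omega> - S)|?M. ?h w) =
          (LINT w:S|?M. ?h w) + (LINT w:?\<Omega> - S|?M. ?h w)"
        by (rule set_integral_Un) (use compl sig sets.compl_sets[of S ?M] sp h in auto)
      ultimately show ?case using total compl.IH by simp
    next
      case (union A)
      have A: "A i \<in> sets ?M" for i using union sig by auto
      then have "(LINT w:(\<Union>i. A i)|?M. ?h w) = (\<Sum>i. LINT w:A i|?M. ?h w)"
        using union(1) by (intro lebesgue_integral_countable_add h)
          (auto simp: disjoint_family_on_def)
      then show ?case using union by simp
    qed
  qed
  then have "AE w in ?M. ?h w = 0"
    by (intro AE_zero_if_set_integrals_zero) (use f g in auto)
  then show ?thesis by simp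
qed

text \<open>
Write \<open>g\<close> for the partial integral of \<open>h\<close> over the second coordinate. Summing over all \<open>y\<close> of level \<open>m\<close>
gives the integral of \<open>g\<close> over the cylinder of \<open>x\<close>; since the summands are all equal, each of them is
this integral divided by the number of \<open>y\<close>, which is the integral of \<open>g\<close> over the rectangle of \<open>x\<close>
and \<open>y\<close>.
\<close>

lemma AE_eq_slice_fst:
  fixes h :: "(nat \<Rightarrow> nat) \<times> (nat \<Rightarrow> nat) \<Rightarrow> complex"
  assumes d: "inductive_family dX" "inductive_family dY"
    and h [measurable]: "h \<in> borel_measurable (mu dX \<Otimes>\<^sub>M mu dY)" and c: "\<And>w. norm (h w) \<le> c"
    and indep: "\<And>m x y y'. k \<le> m \<Longrightarrow> x \<in> level dX m \<Longrightarrow> y \<in> level dY m \<Longrightarrow> y' \<in> level dY m \<Longrightarrow>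
      (LINT w:cyl dX m x \<times> cyl dY m y|mu dX \<Otimes>\<^sub>M mu dY. h w) =
      (LINT w:cyl dX m x \<times> cyl dY m y'|mu dX \<Otimes>\<^sub>M mu dY. h w)"
  shows "AE w in mu dX \<Otimes>\<^sub>M mu dY. h w = (LINT v|mu dY. h (fst w, v))"
proof -
  let ?M = "mu dX \<Otimes>\<^sub>M mu dY"
  interpret XY: pair_prob_space "mu dX" "mu dY" using d by (rule pair_prob_space_mu)
  define g where "g u = (LINT v|mu dY. h (u, v))" for u
  have [measurable]: "g \<in> borel_measurable (mu dX)"
    unfolding g_def by measurable
  have int_h: "integrable ?M h"
    by (rule XY.P.integrable_const_bound[where B = c]) (use c in auto)
  have g_le: "norm (g u) \<le> c" if "u \<in> space (mu dX)" for u
  proof -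
    have "(\<lambda>v. h (u, v)) \<in> borel_measurable (mu dY)" using that by measurable
    then have "integrable (mu dY) (\<lambda>v. h (u, v))"
      by (intro XY.M2.integrable_const_bound[where B = c]) (use c in auto)
    then have "norm (g u) \<le> (LINT v|mu dY. norm (h (u, v)))"
      unfolding g_def by (intro integral_norm_bound)
    also have "\<dots> \<le> (LINT v|mu dY. c)"
      using \<open>integrable (mu dY) (\<lambda>v. h (u, v))\<close> c by (intro integral_mono) auto
    finally show ?thesis by (simp add: XY.M2.prob_space)
  qed
  have int_g: "integrable ?M (\<lambda>w. g (fst w))"
    by (rule XY.P.integrable_const_bound[where B = c])
      (use g_le AE_space in \<open>auto simp: space_pair_measure\<close>)
  have prod: "(LINT w:A \<times> B|?M. f w) = (LINT u:A|mu dX. LINT v:B|mu dY. f (u, v))"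
    if "integrable ?M f" "A \<in> sets (mu dX)" "B \<in> sets (mu dY)" for A B and f :: "_ \<Rightarrow> complex"
  proof -
    have "(LINT w:A \<times> B|?M. f w) =
        (LINT u|mu dX. LINT v|mu dY. indicator (A \<times> B) (u, v) *\<^sub>R f (u, v))"
      unfolding set_lebesgue_integral_def using that
      by (intro XY.integral_fst'[symmetric] integrable_mult_indicator) auto
    then show ?thesis
      by (simp add: set_lebesgue_integral_def indicator_times del: scaleR_scaleR
          flip: scaleR_scaleR)
  qed
  have "(LINT w:cyl dX m x \<times> cyl dY m y|?M. h w) = (LINT w:cyl dX m x \<times> cyl dY m y|?M. g (fst w))"
    if m: "k \<le> m" and x: "x \<in> level dX m" and y: "y \<in> level dY m" for m x y
  proof -
    let ?N = "card (level dY m)"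
    have "?N > 0" using y by (auto simp: card_gt_0_iff finite_level)
    have "(LINT u:cyl dX m x|mu dX. g u) = (LINT w:cyl dX m x \<times> Omega dY|?M. h w)"
      by (subst prod[OF int_h])
        (auto simp: g_def set_lebesgue_integral_def sets_cyl simp flip: space_mu
          intro!: Bochner_Integration.integral_cong)
    also have "cyl dX m x \<times> Omega dY = (\<Union>y'\<in>level dY m. cyl dX m x \<times> cyl dY m y')"
      unfolding UN_cyl[of dY m, symmetric] by auto
    also have "(LINT w:\<dots>|?M. h w) = (\<Sum>y'\<in>level dY m. LINT w:cyl dX m x \<times> cyl dY m y'|?M. h w)"
    proof (rule set_integral_finite_Union[where A = "\<lambda>y'. cyl dX m x \<times> cyl dY m y'"])
      show "set_integrable ?M (cyl dX m x \<times> cyl dY m y') h" for y'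
        unfolding set_integrable_def using int_h sets_cyl_times by (intro integrable_mult_indicator)
      show "disjoint_family_on (\<lambda>y'. cyl dX m x \<times> cyl dY m y') (level dY m)"
        by (auto simp: disjoint_family_on_def cyl_def)
    qed (auto simp: finite_level sets_cyl_times)
    also have "\<dots> = (\<Sum>y'\<in>level dY m. LINT w:cyl dX m x \<times> cyl dY m y|?M. h w)"
      using indep[OF m x _ y] by (intro sum.cong) auto
    finally have "(LINT w:cyl dX m x \<times> cyl dY m y|?M. h w) = (LINT u:cyl dX m x|mu dX. g u) / ?N"
      using \<open>?N > 0\<close> by simp
    also have "\<dots> = (LINT w:cyl dX m x \<times> cyl dY m y|?M. g (fst w))"
      using measure_cyl[OF d(2) y]
      by (subst prod[OF int_g]) (auto simp: set_lebesgue_integral_def sets_cyl scaleR_conv_of_real)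
    finally show ?thesis .
  qed
  from AE_eq_if_cyl_integrals_eq[OF int_h int_g this] show ?thesis by (simp add: g_def)
qed

section \<open>Functions of one coordinate\<close>

(*CUT*)
text \<open>
The case \<open>AE_eq_slice_fst\<close> applied to \<open>h\<close> with its two arguments exchanged.
\<close>

lemma AE_eq_slice_snd:
  fixes h :: "(nat \<Rightarrow> nat) \<times> (nat \<Rightarrow> nat) \<Rightarrow> complex"
  assumes d: "inductive_family dX" "inductive_family dY"
    and h [measurable]: "h \<in> borel_measurable (mu dX \<Otimes>\<^sub>M mu dY)" and c: "\<And>w. norm (h w) \<le> c"
    and indep: "\<And>m x x' y. k \<le> m \<Longrightarrow> x \<in> level dX m \<Longrightarrow> x' \<in> level dX m \<Longrightarrow> y \<in> level dY m \<Longrightarrow>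
      (LINT w:cyl dX m x \<times> cyl dY m y|mu dX \<Otimes>\<^sub>M mu dY. h w) =
      (LINT w:cyl dX m x' \<times> cyl dY m y|mu dX \<Otimes>\<^sub>M mu dY. h w)"
  shows "AE w in mu dX \<Otimes>\<^sub>M mu dY. h w = (LINT u|mu dX. h (u, snd w))"
proof -
  interpret XY: pair_prob_space "mu dX" "mu dY" using d by (rule pair_prob_space_mu)
  interpret YX: pair_prob_space "mu dY" "mu dX" using d(2,1) by (rule pair_prob_space_mu)
  let ?h = "\<lambda>(v, u). h (u, v)"
  have swap: "(LINT w:cyl dY m y \<times> cyl dX m x|mu dY \<Otimes>\<^sub>M mu dX. ?h w) =
      (LINT w:cyl dX m x \<times> cyl dY m y|mu dX \<Otimes>\<^sub>M mu dY. h w)" for m x y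
  proof -
    have [measurable]: "cyl dX m x \<times> cyl dY m y \<in> sets (mu dX \<Otimes>\<^sub>M mu dY)" by (rule sets_cyl_times)
    have "(LINT w:cyl dY m y \<times> cyl dX m x|mu dY \<Otimes>\<^sub>M mu dX. ?h w) =
        integral\<^sup>L (mu dY \<Otimes>\<^sub>M mu dX)
          (\<lambda>(v, u). indicator (cyl dX m x \<times> cyl dY m y) (u, v) *\<^sub>R h (u, v))"
      unfolding set_lebesgue_integral_def
      by (intro Bochner_Integration.integral_cong) (auto simp: indicator_def)
    also have "\<dots> = (LINT w:cyl dX m x \<times> cyl dY m y|mu dX \<Otimes>\<^sub>M mu dY. h w)"
      unfolding set_lebesgue_integral_def by (rule XY.integral_product_swap) measurable
    finally show ?thesis .
  qed
  have "AE w in mu dY \<Otimes>\<^sub>M mu dX. ?h w = (LINT u|mu dX. ?h (fst w, u))"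
  proof (rule AE_eq_slice_fst[OF d(2,1)])
    show "?h \<in> borel_measurable (mu dY \<Otimes>\<^sub>M mu dX)" by measurable
    show "norm (?h w) \<le> c" for w using c by (simp add: case_prod_unfold)
  qed (unfold swap, rule indep)
  then have "AE w in distr (mu dX \<Otimes>\<^sub>M mu dY) (mu dY \<Otimes>\<^sub>M mu dX) (\<lambda>(x, y). (y, x)).
      ?h w = (LINT u|mu dX. ?h (fst w, u))"
    by (simp only: YX.distr_pair_swap[symmetric])
  from AE_distrD[OF measurable_pair_swap' this] show ?thesis
    by (simp add: case_prod_unfold)
qed

text \<open>
A bound at every point makes all slices integrable.
\<close>

lemma linf_fun_bounded_version:
  assumes "f \<in> linf_fun M"
  obtains h c where "h \<in> borel_measurable M" "\<And>x. norm (h x) \<le> c" "AE x in M. h x = f x"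
proof -
  obtain c where c: "AE x in M. norm (f x) \<le> c" and [measurable]: "f \<in> borel_measurable M"
    using assms by (auto simp: linf_fun_def)
  show thesis
  proof (rule that)
    show "(\<lambda>x. if norm (f x) \<le> c then f x else 0) \<in> borel_measurable M" by measurable
    show "norm (if norm (f x) \<le> c then f x else 0) \<le> max c 0" for x by auto
    show "AE x in M. (if norm (f x) \<le> c then f x else 0) = f x"
      using c by eventually_elim simp
  qed
qed

lemma cond_exp2_cong:
  assumes "x \<in> level dX m" "y \<in> level dY m" "h \<in> borel_measurable (mu dX \<Otimes>\<^sub>M mu dY)"
    and "rep F \<in> borel_measurable (mu dX \<Otimes>\<^sub>M mu dY)"
    and "AE w in mu dX \<Otimes>\<^sub>M mu dY. h w = rep F w"
  shows "cond_exp2 dX dY m F (x, y) = of_nat (card (level dX m)) * of_nat (card (level dY m)) *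
     (LINT w:cyl dX m x \<times> cyl dY m y|mu dX \<Otimes>\<^sub>M mu dY. h w)"
proof -
  have [measurable]: "cyl dX m x \<times> cyl dY m y \<in> sets (mu dX \<Otimes>\<^sub>M mu dY)" by (rule sets_cyl_times)
  note assms(3,4) [measurable]
  have "(LINT w:cyl dX m x \<times> cyl dY m y|mu dX \<Otimes>\<^sub>M mu dY. rep F w) =
      (LINT w:cyl dX m x \<times> cyl dY m y|mu dX \<Otimes>\<^sub>M mu dY. h w)"
    unfolding set_lebesgue_integral_def
    by (rule integral_cong_AE) (use assms(5) in \<open>auto elim: eventually_mono\<close>)
  then show ?thesis using assms(1,2) by (simp add: cond_exp2_def)
qed

lemma cond_exp2_eq_iff_integral_eq:
  assumes "x \<in> level dX m" "y \<in> level dY m" "x' \<in> level dX m" "y' \<in> level dY m"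
    "h \<in> borel_measurable (mu dX \<Otimes>\<^sub>M mu dY)"
    "rep F \<in> borel_measurable (mu dX \<Otimes>\<^sub>M mu dY)"
    "AE w in mu dX \<Otimes>\<^sub>M mu dY. h w = rep F w"
  shows "cond_exp2 dX dY m F (x, y) = cond_exp2 dX dY m F (x', y') \<longleftrightarrow>
    (LINT w:cyl dX m x \<times> cyl dY m y|mu dX \<Otimes>\<^sub>M mu dY. h w) =
    (LINT w:cyl dX m x' \<times> cyl dY m y'|mu dX \<Otimes>\<^sub>M mu dY. h w)"
proof -
  have "card (level dX m) \<noteq> 0" "card (level dY m) \<noteq> 0"
    using assms(1,2) by (auto simp: finite_level)
  then show ?thesis
    by (simp add: cond_exp2_cong[OF assms(1,2,5-7)] cond_exp2_cong[OF assms(3,4,5-7)])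
qed

text \<open>
The values of \<open>cond_exp2\<close> are the integrals over rectangles up to a constant that depends on the
level only.
\<close>

lemma depends_on_fst_if_cond_exp2:
  assumes d: "inductive_family dX" "inductive_family dY"
    and F: "F \<in> carrier (Linf_tensor_alg dX dY)"
    and indep: "\<And>m x y y'. k \<le> m \<Longrightarrow> x \<in> level dX m \<Longrightarrow> y \<in> level dY m \<Longrightarrow> y' \<in> level dY m \<Longrightarrow>
      cond_exp2 dX dY m F (x, y) = cond_exp2 dX dY m F (x, y')"
  shows "\<exists>g\<in>borel_measurable (mu dX). AE w in mu dX \<Otimes>\<^sub>M mu dY. rep F w = g (fst w)"
proof -
  interpret XY: pair_prob_space "mu dX" "mu dY" using d by (rule pair_prob_space_mu)
  obtain h c where h: "h \<in> borel_measurable (mu dX \<Otimes>\<^sub>M mu dY)" "\<And>w. norm (h w) \<le> c"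
    and h_eq: "AE w in mu dX \<Otimes>\<^sub>M mu dY. h w = rep F w"
    using linf_fun_bounded_version[OF rep_in_linf_fun[OF F]] by blast
  note [measurable] = h(1)
  have repF: "rep F \<in> borel_measurable (mu dX \<Otimes>\<^sub>M mu dY)"
    using rep_in_linf_fun[OF F] by (simp add: linf_fun_def)
  have "AE w in mu dX \<Otimes>\<^sub>M mu dY. h w = (LINT v|mu dY. h (fst w, v))"
  proof (rule AE_eq_slice_fst[OF d h])
    fix m x y y' assume m: "k \<le> m" and l: "x \<in> level dX m" "y \<in> level dY m" "y' \<in> level dY m"
    show "(LINT w:cyl dX m x \<times> cyl dY m y|mu dX \<Otimes>\<^sub>M mu dY. h w) =
        (LINT w:cyl dX m x \<times> cyl dY m y'|mu dX \<Otimes>\<^sub>M mu dY. h w)"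
      using indep[OF m l] cond_exp2_eq_iff_integral_eq[OF l(1,2,1,3) h(1) repF h_eq] by simp
  qed
  then have "AE w in mu dX \<Otimes>\<^sub>M mu dY. rep F w = (LINT v|mu dY. h (fst w, v))"
    using h_eq by eventually_elim simp
  moreover have "(\<lambda>u. LINT v|mu dY. h (u, v)) \<in> borel_measurable (mu dX)" by measurable
  ultimately show ?thesis by (auto intro!: bexI[where x = "\<lambda>u. LINT v|mu dY. h (u, v)"])
qed

lemma depends_on_snd_if_cond_exp2:
  assumes d: "inductive_family dX" "inductive_family dY"
    and F: "F \<in> carrier (Linf_tensor_alg dX dY)"
    and indep: "\<And>m x x' y. k \<le> m \<Longrightarrow> x \<in> level dX m \<Longrightarrow> x' \<in> level dX m \<Longrightarrow> y \<in> level dY m \<Longrightarrow>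
      cond_exp2 dX dY m F (x, y) = cond_exp2 dX dY m F (x', y)"
  shows "\<exists>g\<in>borel_measurable (mu dY). AE w in mu dX \<Otimes>\<^sub>M mu dY. rep F w = g (snd w)"
proof -
  interpret XY: pair_prob_space "mu dX" "mu dY" using d by (rule pair_prob_space_mu)
  obtain h c where h: "h \<in> borel_measurable (mu dX \<Otimes>\<^sub>M mu dY)" "\<And>w. norm (h w) \<le> c"
    and h_eq: "AE w in mu dX \<Otimes>\<^sub>M mu dY. h w = rep F w"
    using linf_fun_bounded_version[OF rep_in_linf_fun[OF F]] by blast
  note [measurable] = h(1)
  have repF: "rep F \<in> borel_measurable (mu dX \<Otimes>\<^sub>M mu dY)"
    using rep_in_linf_fun[OF F] by (simp add: linf_fun_def)
  have "AE w in mu dX \<Otimes>\<^sub>M mu dY. h w = (LINT u|mu dX. h (u, snd w))"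
  proof (rule AE_eq_slice_snd[OF d h])
    fix m x x' y assume m: "k \<le> m" and l: "x \<in> level dX m" "x' \<in> level dX m" "y \<in> level dY m"
    show "(LINT w:cyl dX m x \<times> cyl dY m y|mu dX \<Otimes>\<^sub>M mu dY. h w) =
        (LINT w:cyl dX m x' \<times> cyl dY m y|mu dX \<Otimes>\<^sub>M mu dY. h w)"
      using indep[OF m l] cond_exp2_eq_iff_integral_eq[OF l(1,3,2,3) h(1) repF h_eq] by simp
  qed
  then have "AE w in mu dX \<Otimes>\<^sub>M mu dY. rep F w = (LINT u|mu dX. h (u, snd w))"
    using h_eq by eventually_elim simp
  moreover have "(\<lambda>v. LINT u|mu dX. h (u, v)) \<in> borel_measurable (mu dY)" by measurable
  ultimately show ?thesis by (auto intro!: bexI[where x = "\<lambda>v. LINT u|mu dX. h (u, v)"])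
qed

text \<open>
The approximating functions \<open>g\<^sub>j \<circ> \<pi>\<close> converge almost everywhere to \<open>f\<close>, so \<open>lim g\<^sub>j\<close> is the function
sought. It is cut off at an essential bound of \<open>f\<close> to make it bounded everywhere on \<open>M\<close>; the range
of \<open>\<pi>\<close> need not have full measure.
\<close>

lemma factors_through_limit:
  fixes f :: "'a \<Rightarrow> complex"
  assumes \<pi> [measurable]: "\<pi> \<in> N \<rightarrow>\<^sub>M M" and f: "f \<in> linf_fun N"
    and approx: "\<And>e::real. e > 0 \<Longrightarrow>
      \<exists>g\<in>borel_measurable M. AE w in N. norm (f w - g (\<pi> w)) \<le> e"
  shows "\<exists>g\<in>linf_fun M. AE w in N. f w = g (\<pi> w)"
proof -
  have "\<forall>j. \<exists>g\<in>borel_measurable M. AE w in N. norm (f w - g (\<pi> w)) \<le> inverse (Suc j)"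
    using approx by simp
  then obtain g where g [measurable]: "\<And>j. g j \<in> borel_measurable M"
    and g_approx: "\<And>j. AE w in N. norm (f w - g j (\<pi> w)) \<le> inverse (Suc j)"
    by metis
  define G where "G u = lim (\<lambda>j. g j u)" for u
  have [measurable]: "G \<in> borel_measurable M" unfolding G_def by measurable
  have "AE w in N. \<forall>j. norm (f w - g j (\<pi> w)) \<le> inverse (Suc j)"
    using g_approx by (simp add: AE_all_countable)
  then have G: "AE w in N. f w = G (\<pi> w)"
  proof eventually_elim
    case (elim w)
    have "(\<lambda>j. f w - g j (\<pi> w)) \<longlonglongrightarrow> 0"
      by (rule Lim_null_comparison[OF _ LIMSEQ_inverse_real_of_nat]) (use elim in auto)
    then have "(\<lambda>j. f w - (f w - g j (\<pi> w))) \<longlonglongrightarrow> f w - 0" by (intro tendsto_intros)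
    then show ?case by (simp add: G_def limI)
  qed
  obtain c where c: "AE w in N. norm (f w) \<le> c" using f by (auto simp: linf_fun_def)
  show ?thesis
  proof
    show "(\<lambda>u. if norm (G u) \<le> c then G u else 0) \<in> linf_fun M"
      by (rule linf_funI[where c = "max c 0"]) auto
    show "AE w in N. f w = (if norm (G (\<pi> w)) \<le> c then G (\<pi> w) else 0)"
      using G c by eventually_elim auto
  qed
qed

lemma linf_tensorI:
  assumes d: "inductive_family dX" "inductive_family dY"
    and F: "F \<in> carrier (Linf_tensor_alg dX dY)"
    and g: "g \<in> linf_fun (mu dX)" and h: "h \<in> linf_fun (mu dY)"
    and eq: "AE w in mu dX \<Otimes>\<^sub>M mu dY. rep F w = g (fst w) * h (snd w)"
  shows "F = linf_tensor (mu dX) (mu dY) (linf_class (mu dX) g) (linf_class (mu dY) h)"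
proof -
  interpret XY: pair_prob_space "mu dX" "mu dY" using d by (rule pair_prob_space_mu)
  let ?g = "rep (linf_class (mu dX) g)" and ?h = "rep (linf_class (mu dY) h)"
  have [measurable]: "g \<in> borel_measurable (mu dX)" "?g \<in> borel_measurable (mu dX)"
    "h \<in> borel_measurable (mu dY)" "?h \<in> borel_measurable (mu dY)"
    using g rep_linf_class(1)[OF g] h rep_linf_class(1)[OF h] by (auto simp: linf_fun_def)
  have "AE w in mu dX \<Otimes>\<^sub>M mu dY. ?g (fst w) = g (fst w)"
    by (rule XY.AE_pair_measure) (use rep_linf_class(2)[OF g] in \<open>auto elim: eventually_mono\<close>)
  moreover have "AE w in mu dX \<Otimes>\<^sub>M mu dY. ?h (snd w) = h (snd w)"
    by (rule XY.AE_pair_measure) (use rep_linf_class(2)[OF h] in auto)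
  ultimately have ae: "AE w in mu dX \<Otimes>\<^sub>M mu dY. rep F w = (case w of (x, y) \<Rightarrow> ?g x * ?h y)"
    using eq by eventually_elim (simp add: case_prod_unfold)
  have "(\<lambda>(x, y). ?g x * ?h y) \<in> linf_fun (mu dX \<Otimes>\<^sub>M mu dY)"
  proof -
    obtain c where "AE w in mu dX \<Otimes>\<^sub>M mu dY. norm (rep F w) \<le> c"
      using rep_in_linf_fun[OF F] by (auto simp: linf_fun_def)
    with ae have "AE w in mu dX \<Otimes>\<^sub>M mu dY. norm (case w of (x, y) \<Rightarrow> ?g x * ?h y) \<le> c"
      by eventually_elim simp
    then show ?thesis by (intro linf_funI) measurable
  qed
  then show ?thesis
    using ae linf_class_eq_iff[OF rep_in_linf_fun[OF F]] linf_class_rep[OF F]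
    by (simp add: linf_tensor_def)
qed

section \<open>Bounds for unital completely positive maps\<close>

lemma one_in_C_alg: "\<one>\<^bsub>C_alg T\<^esub> \<in> carrier (C_alg T)"
  by (simp add: C_alg_def continuous_map_restrict)

lemma linear_C_Linf_comb:
  assumes lin: "linear_map (C_alg T) (Linf_alg M) \<Gamma>"
    and f: "f \<in> carrier (C_alg T)" and g: "g \<in> carrier (C_alg T)"
  shows "AE w in M. rep (\<Gamma> (\<lambda>x\<in>topspace T. a * f x + b * g x)) w =
    a * rep (\<Gamma> f) w + b * rep (\<Gamma> g) w"
proof -
  have sm: "c \<odot>\<^bsub>C_alg T\<^esub> h \<in> carrier (C_alg T)" if "h \<in> carrier (C_alg T)" for c h
    using that by (simp add: C_alg_def continuous_map_restrict)
      (simp add: continuous_map_atin tendsto_mult_left)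
  have \<Gamma>: "\<Gamma> h \<in> carrier (Linf_alg M)" if "h \<in> carrier (C_alg T)" for h
    using lin that by (auto simp: linear_map_def)
  have "(\<lambda>x\<in>topspace T. a * f x + b * g x) = a \<odot>\<^bsub>C_alg T\<^esub> f \<oplus>\<^bsub>C_alg T\<^esub> b \<odot>\<^bsub>C_alg T\<^esub> g"
    by (auto simp: C_alg_def fun_eq_iff)
  then have "\<Gamma> (\<lambda>x\<in>topspace T. a * f x + b * g x) =
      a \<odot>\<^bsub>Linf_alg M\<^esub> \<Gamma> f \<oplus>\<^bsub>Linf_alg M\<^esub> b \<odot>\<^bsub>Linf_alg M\<^esub> \<Gamma> g"
    using lin f g sm by (simp add: linear_map_def)
  moreover have "AE w in M. rep (a \<odot>\<^bsub>Linf_alg M\<^esub> \<Gamma> f \<oplus>\<^bsub>Linf_alg M\<^esub> b \<odot>\<^bsub>Linf_alg M\<^esub> \<Gamma> g) w =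
      a * rep (\<Gamma> f) w + b * rep (\<Gamma> g) w"
    using Linf_add(2)[OF Linf_smult(1)[OF \<Gamma>[OF f], of a] Linf_smult(1)[OF \<Gamma>[OF g], of b]]
      Linf_smult(2)[OF \<Gamma>[OF f], of a] Linf_smult(2)[OF \<Gamma>[OF g], of b]
    by eventually_elim simp
  ultimately show ?thesis by simp
qed

text \<open>
A nonnegative continuous function is the square of its root, hence positive as a \<open>1 \<times> 1\<close> matrix.
\<close>

lemma completely_positive_nonneg:
  assumes cp: "completely_positive (C_alg T) (Linf_alg M) \<Gamma>"
    and f: "f \<in> carrier (C_alg T)" and pos: "\<And>x. x \<in> topspace T \<Longrightarrow> f x \<in> \<real> \<and> 0 \<le> Re (f x)"
  shows "AE w in M. rep (\<Gamma> f) w \<in> \<real> \<and> 0 \<le> Re (rep (\<Gamma> f) w)"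
proof -
  define s where "s = (\<lambda>x\<in>topspace T. complex_of_real (sqrt (Re (f x))))"
  have "s \<in> carrier (C_alg T)"
    using C_alg_continuous[OF f] unfolding s_def
    by (intro C_alg_carrierI) (simp add: continuous_map_atin tendsto_Re tendsto_real_sqrt tendsto_of_real)
  moreover have "f x = cnj (s x) * s x" if "x \<in> topspace T" for x
    using pos[OF that] that by (auto simp: s_def complex_is_Real_iff complex_eq_iff)
  then have "f = (\<lambda>x\<in>topspace T. \<Sum>l<(1::nat). cnj (s x) * s x)"
    using f by (auto simp: fun_eq_iff C_alg_def extensional_def)
  ultimately have "positive_matrix (C_alg T) 1 (\<lambda>_ _. f)"
    unfolding C_alg_def positive_matrix_fun_algebra[OF fun_star_closed_continuous]
    by (intro exI[of _ "\<lambda>_ _. s"]) simp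
  then have "positive_matrix (Linf_alg M) 1 (\<lambda>_ _. \<Gamma> f)"
    using cp f by (auto simp: completely_positive_def)
  then obtain C where "\<And>i j. i < (1::nat) \<Longrightarrow> j < (1::nat) \<Longrightarrow>
      AE x in M. rep (\<Gamma> f) x = (\<Sum>l<(1::nat). cnj (C l i x) * C l j x)"
    by (rule positive_matrix_LinfD) blast
  from this[of 0 0] have "AE x in M. rep (\<Gamma> f) x = cnj (C 0 0 x) * C 0 0 x" by simp
  then show ?thesis by eventually_elim (simp add: complex_is_Real_iff)
qed

text \<open>
For real \<open>f\<close> apply positivity to \<open>e + f\<close> and \<open>e - f\<close>. Treating real and imaginary parts
separately costs the factor \<open>2\<close>, which is harmless for continuity.
\<close>

lemma ucp_norm_bound:
  assumes "ucp (C_alg T) (Linf_alg M) \<Gamma>"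
    and f: "f \<in> carrier (C_alg T)" and e: "\<And>x. x \<in> topspace T \<Longrightarrow> norm (f x) \<le> e"
  shows "AE w in M. norm (rep (\<Gamma> f) w) \<le> 2 * e"
proof -
  have cp: "completely_positive (C_alg T) (Linf_alg M) \<Gamma>"
    and lin: "linear_map (C_alg T) (Linf_alg M) \<Gamma>"
    and one: "\<Gamma> (\<one>\<^bsub>C_alg T\<^esub>) = \<one>\<^bsub>Linf_alg M\<^esub>"
    using assms(1) by (auto simp: ucp_def completely_positive_def)
  have real: "AE w in M. rep (\<Gamma> u) w \<in> \<real> \<and> \<bar>Re (rep (\<Gamma> u) w)\<bar> \<le> e"
    if u: "u \<in> carrier (C_alg T)" and ue: "\<And>x. x \<in> topspace T \<Longrightarrow> u x \<in> \<real> \<and> \<bar>Re (u x)\<bar> \<le> e" for u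
  proof -
    have *: "AE w in M. complex_of_real e + s * rep (\<Gamma> u) w \<in> \<real> \<and>
        0 \<le> Re (complex_of_real e + s * rep (\<Gamma> u) w)" if s: "s = 1 \<or> s = -1" for s
    proof -
      let ?g = "\<lambda>x\<in>topspace T. of_real e * \<one>\<^bsub>C_alg T\<^esub> x + s * u x"
      have "AE w in M. rep (\<Gamma> ?g) w \<in> \<real> \<and> 0 \<le> Re (rep (\<Gamma> ?g) w)"
      proof (rule completely_positive_nonneg[OF cp])
        show "?g \<in> carrier (C_alg T)"
          using C_alg_continuous[OF u] C_alg_continuous[OF one_in_C_alg[of T]]
          by (intro C_alg_carrierI) (simp add: continuous_map_atin tendsto_add tendsto_mult_left)
        show "?g x \<in> \<real> \<and> 0 \<le> Re (?g x)" if "x \<in> topspace T" for x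
          using s ue[OF that] that by (auto simp: C_alg_def abs_le_iff)
      qed
      with linear_C_Linf_comb[OF lin one_in_C_alg u, of "of_real e" s] rep_one[of M] show ?thesis
        unfolding one by eventually_elim simp
    qed
    from *[OF disjI1[OF refl]] *[OF disjI2[OF refl]] show ?thesis
      by eventually_elim (auto simp: complex_is_Real_iff)
  qed
  define u where "u = (\<lambda>x\<in>topspace T. complex_of_real (Re (f x)))"
  define v where "v = (\<lambda>x\<in>topspace T. complex_of_real (Im (f x)))"
  have uv: "u \<in> carrier (C_alg T)" "v \<in> carrier (C_alg T)"
    using C_alg_continuous[OF f] unfolding u_def v_def
    by (intro C_alg_carrierI; simp add: continuous_map_atin tendsto_Re tendsto_Im tendsto_of_real)+
  have f_eq: "f = (\<lambda>x\<in>topspace T. 1 * u x + \<i> * v x)"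
    using f by (auto simp: fun_eq_iff u_def v_def C_alg_def extensional_def complex_eq_iff)
  have "AE w in M. rep (\<Gamma> u) w \<in> \<real> \<and> \<bar>Re (rep (\<Gamma> u) w)\<bar> \<le> e"
    by (rule real[OF uv(1)]) (use order_trans[OF abs_Re_le_cmod e] in \<open>simp add: u_def\<close>)
  moreover have "AE w in M. rep (\<Gamma> v) w \<in> \<real> \<and> \<bar>Re (rep (\<Gamma> v) w)\<bar> \<le> e"
    by (rule real[OF uv(2)]) (use order_trans[OF abs_Im_le_cmod e] in \<open>simp add: v_def\<close>)
  moreover note linear_C_Linf_comb[OF lin uv, of 1 \<i>]
  ultimately show ?thesis
  proof eventually_elim
    case (elim w)
    have "norm (rep (\<Gamma> f) w) \<le> norm (rep (\<Gamma> u) w) + norm (\<i> * rep (\<Gamma> v) w)"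
      using elim(3) norm_triangle_ineq[of "rep (\<Gamma> u) w"] unfolding f_eq[symmetric] by simp
    also have "\<dots> = \<bar>Re (rep (\<Gamma> u) w)\<bar> + \<bar>Re (rep (\<Gamma> v) w)\<bar>"
      using elim(1,2) by (simp add: norm_mult in_Reals_norm cmod_eq_Re complex_is_Real_iff)
    finally show ?case using elim(1,2) by simp
  qed
qed

section \<open>Complete positivity of the associated family\<close>

text \<open>
For almost every \<open>w\<close>, the quadratic form of \<open>P(w) = C(w)\<^sup>* C(w)\<close> at \<open>v\<close> is the squared norm of
\<open>C(w) v\<close>, and integration preserves nonnegativity.
\<close>

lemma (in finite_measure) pos_semidef_set_integral:
  assumes P: "positive_matrix (Linf_alg M) k P" and PL: "\<And>i j. i < k \<Longrightarrow> j < k \<Longrightarrow> P i j \<in> carrier (Linf_alg M)"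
    and S [measurable]: "S \<in> sets M"
  shows "pos_semidef {..<k} (\<lambda>i j. LINT w:S|M. rep (P i j) w)"
proof -
  obtain C where C: "\<And>i j. i < k \<Longrightarrow> j < k \<Longrightarrow> C i j \<in> linf_fun M"
    and PC: "\<And>i j. i < k \<Longrightarrow> j < k \<Longrightarrow>
      AE x in M. rep (P i j) x = (\<Sum>l<k. cnj (C l i x) * C l j x)"
    using positive_matrix_LinfD[OF P] by blast
  define Q where "Q i j x = (\<Sum>l<k. cnj (C l i x) * C l j x)" for i j x
  have Q: "Q i j \<in> linf_fun M" if "i < k" "j < k" for i j
    unfolding Q_def using C that by (intro linf_fun_sum linf_fun_mult linf_fun_cnj) auto
  have int: "integrable M (\<lambda>w. indicator S w *\<^sub>R Q i j w)" if "i < k" "j < k" for i j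
    using integrable_linf[OF Q[OF that]] S by (intro integrable_mult_indicator)
  have eq: "(LINT w:S|M. rep (P i j) w) = (LINT w|M. indicator S w *\<^sub>R Q i j w)"
    if "i < k" "j < k" for i j
  proof -
    have [measurable]: "rep (P i j) \<in> borel_measurable M" "Q i j \<in> borel_measurable M"
      using rep_in_linf_fun[OF PL[OF that]] Q[OF that] by (auto simp: linf_fun_def)
    have "AE w in M. rep (P i j) w = Q i j w" using PC[OF that] by (simp add: Q_def)
    then show ?thesis
      unfolding set_lebesgue_integral_def
      by (intro integral_cong_AE) (auto elim: eventually_mono)
  qed
  have "pos_semidef {..<k} (\<lambda>i j. LINT w|M. indicator S w *\<^sub>R Q i j w)"
    unfolding pos_semidef_def
  proof (intro conjI ballI allI)
    fix i j
    have "(LINT w|M. cnj (indicator S w *\<^sub>R Q i j w)) = cnj (LINT w|M. indicator S w *\<^sub>R Q i j w)"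
      by (rule Bochner_Integration.integral_cnj)
    moreover have "cnj (Q i j w) = Q j i w" for w
      by (simp add: Q_def mult.commute)
    ultimately show "(LINT w|M. indicator S w *\<^sub>R Q j i w) = cnj (LINT w|M. indicator S w *\<^sub>R Q i j w)"
      by simp
  next
    fix v :: "nat \<Rightarrow> complex"
    have gram: "(\<Sum>i<k. \<Sum>j<k. cnj (v i) * Q i j w * v j) =
        of_real (\<Sum>l<k. (cmod (\<Sum>j<k. C l j w * v j))\<^sup>2)" for w
    proof -
      have "(\<Sum>i<k. \<Sum>j<k. cnj (v i) * Q i j w * v j) =
          (\<Sum>i<k. \<Sum>j<k. \<Sum>l<k. cnj (C l i w * v i) * (C l j w * v j))"
        by (simp add: Q_def sum_distrib_left sum_distrib_right ac_simps)
      also have "\<dots> = (\<Sum>i<k. \<Sum>l<k. \<Sum>j<k. cnj (C l i w * v i) * (C l j w * v j))"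
        by (intro sum.cong refl sum.swap)
      also have "\<dots> = (\<Sum>l<k. \<Sum>i<k. \<Sum>j<k. cnj (C l i w * v i) * (C l j w * v j))"
        by (rule sum.swap)
      also have "\<dots> = (\<Sum>l<k. cnj (\<Sum>j<k. C l j w * v j) * (\<Sum>j<k. C l j w * v j))"
        by (simp add: sum_product)
      also have "\<dots> = of_real (\<Sum>l<k. (cmod (\<Sum>j<k. C l j w * v j))\<^sup>2)"
        unfolding of_real_sum by (simp only: mult.commute[of "cnj _"] complex_norm_square)
      finally show ?thesis .
    qed
    have "(\<Sum>i<k. \<Sum>j<k. cnj (v i) * (LINT w|M. indicator S w *\<^sub>R Q i j w) * v j) =
        (LINT w|M. (\<Sum>i<k. \<Sum>j<k. cnj (v i) * (indicator S w *\<^sub>R Q i j w) * v j))"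
    proof -
      have *: "(\<Sum>i<k. \<Sum>j<k. cnj (v i) * integral\<^sup>L M (h i j) * v j) =
          (LINT w|M. (\<Sum>i<k. \<Sum>j<k. cnj (v i) * h i j w * v j))"
        if "\<And>i j. i < k \<Longrightarrow> j < k \<Longrightarrow> integrable M (h i j)" for h
      proof -
        let ?f = "\<lambda>i j w. cnj (v i) * h i j w * v j"
        have I: "integrable M (?f i j)" if "i < k" "j < k" for i j
          using \<open>\<And>i j. i < k \<Longrightarrow> j < k \<Longrightarrow> integrable M (h i j)\<close>[OF that] by simp
        have "(LINT w|M. (\<Sum>i<k. \<Sum>j<k. ?f i j w)) = (\<Sum>i<k. LINT w|M. (\<Sum>j<k. ?f i j w))"
          by (rule Bochner_Integration.integral_sum) (auto intro!: Bochner_Integration.integrable_sum I)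
        also have "\<dots> = (\<Sum>i<k. \<Sum>j<k. LINT w|M. ?f i j w)"
          by (intro sum.cong refl Bochner_Integration.integral_sum I) auto
        finally show ?thesis by simp
      qed
      show ?thesis using int by (rule *)
    qed
    also have "(\<lambda>w. \<Sum>i<k. \<Sum>j<k. cnj (v i) * (indicator S w *\<^sub>R Q i j w) * v j) =
        (\<lambda>w. of_real (indicator S w * (\<Sum>l<k. (cmod (\<Sum>j<k. C l j w * v j))\<^sup>2)))"
      unfolding of_real_mult gram[symmetric] by (simp add: scaleR_conv_of_real sum_distrib_left ac_simps)
    finally have "(\<Sum>i<k. \<Sum>j<k. cnj (v i) * (LINT w|M. indicator S w *\<^sub>R Q i j w) * v j) =
        of_real (LINT w|M. indicator S w * (\<Sum>l<k. (cmod (\<Sum>j<k. C l j w * v j))\<^sup>2))"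
      by (simp only: integral_complex_of_real)
    moreover have "0 \<le> (LINT w|M. indicator S w * (\<Sum>l<k. (cmod (\<Sum>j<k. C l j w * v j))\<^sup>2))"
      by (intro Bochner_Integration.integral_nonneg) (simp add: sum_nonneg)
    ultimately show "0 \<le> Re (\<Sum>i<k. \<Sum>j<k. cnj (v i) * (LINT w|M. indicator S w *\<^sub>R Q i j w) * v j)"
      by simp
  qed
  then show ?thesis by (rule pos_semidef_cong[rotated]) (simp add: eq)
qed

lemma linear_map_cond_exp2:
  assumes d: "inductive_family dX" "inductive_family dY"
  shows "linear_map (Linf_tensor_alg dX dY) (diag_alg (level dX n \<times> level dY n)) (cond_exp2 dX dY n)"
  unfolding linear_map_def
proof (intro conjI ballI allI)
  let ?M = "mu dX \<Otimes>\<^sub>M mu dY"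
  interpret XY: pair_prob_space "mu dX" "mu dY" using d by (rule pair_prob_space_mu)
  have ext: "cond_exp2 dX dY n F \<in> extensional (level dX n \<times> level dY n)" for F
    by (simp add: cond_exp2_def)
  then show "cond_exp2 dX dY n \<in> carrier (Linf_tensor_alg dX dY) \<rightarrow> carrier (diag_alg (level dX n \<times> level dY n))"
    by (simp add: diag_alg_def)
  have meas: "rep F \<in> borel_measurable ?M" if "F \<in> carrier (Linf_tensor_alg dX dY)" for F
    using rep_in_linf_fun[OF that] by (simp add: linf_fun_def)
  have int: "set_integrable ?M (cyl dX n x \<times> cyl dY n y) (rep F)"
    if "F \<in> carrier (Linf_tensor_alg dX dY)" for F x y
    unfolding set_integrable_def
    using XY.P.integrable_linf[OF rep_in_linf_fun[OF that]] sets_cyl_times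
    by (intro integrable_mult_indicator)
  fix F assume F: "F \<in> carrier (Linf_tensor_alg dX dY)"
  {
    fix G assume G: "G \<in> carrier (Linf_tensor_alg dX dY)"
    have "cond_exp2 dX dY n (F \<oplus>\<^bsub>Linf_tensor_alg dX dY\<^esub> G) (x, y) =
        cond_exp2 dX dY n F (x, y) + cond_exp2 dX dY n G (x, y)"
      if xy: "x \<in> level dX n" "y \<in> level dY n" for x y
    proof -
      have "AE w in ?M. rep F w + rep G w = rep (F \<oplus>\<^bsub>Linf_tensor_alg dX dY\<^esub> G) w"
        using Linf_add(2)[OF F G] by eventually_elim simp
      from cond_exp2_cong[OF xy _ meas[OF Linf_add(1)[OF F G]] this] show ?thesis
        using meas[OF F] meas[OF G] int[OF F] int[OF G] xy
        by (simp add: cond_exp2_def set_integral_add algebra_simps)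
    qed
    then show "cond_exp2 dX dY n (F \<oplus>\<^bsub>Linf_tensor_alg dX dY\<^esub> G) =
        cond_exp2 dX dY n F \<oplus>\<^bsub>diag_alg (level dX n \<times> level dY n)\<^esub> cond_exp2 dX dY n G"
      by (intro extensionalityI[OF ext]) (auto simp: diag_alg_def)
  }
  fix c
  have "cond_exp2 dX dY n (c \<odot>\<^bsub>Linf_tensor_alg dX dY\<^esub> F) (x, y) = c * cond_exp2 dX dY n F (x, y)"
    if xy: "x \<in> level dX n" "y \<in> level dY n" for x y
  proof -
    have "AE w in ?M. c * rep F w = rep (c \<odot>\<^bsub>Linf_tensor_alg dX dY\<^esub> F) w"
      using Linf_smult(2)[OF F, of c] by eventually_elim simp
    from cond_exp2_cong[OF xy _ meas[OF Linf_smult(1)[OF F]] this] show ?thesis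
      using meas[OF F] xy by (simp add: cond_exp2_def algebra_simps)
  qed
  then show "cond_exp2 dX dY n (c \<odot>\<^bsub>Linf_tensor_alg dX dY\<^esub> F) =
      c \<odot>\<^bsub>diag_alg (level dX n \<times> level dY n)\<^esub> cond_exp2 dX dY n F"
    by (intro extensionalityI[OF ext]) (auto simp: diag_alg_def)
qed

text \<open>
The constant that normalises the conditional expectation is the inverse of the measure of a
cylinder.
\<close>

lemma cond_exp_one:
  assumes d: "inductive_family d"
  shows "cond_exp d n \<one>\<^bsub>Linf_alg (mu d)\<^esub> = (\<lambda>x\<in>level d n. 1)"
proof -
  interpret prob_space "mu d" using d by (rule prob_space_mu)
  have [measurable]: "rep \<one>\<^bsub>Linf_alg (mu d)\<^esub> \<in> borel_measurable (mu d)"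
    using rep_in_linf_fun[OF Linf_zero_one_closed(2)[of "mu d"]] by (simp add: linf_fun_def)
  have "of_nat (card (level d n)) * (LINT \<omega>:cyl d n x|mu d. rep \<one>\<^bsub>Linf_alg (mu d)\<^esub> \<omega>) = 1"
    if x: "x \<in> level d n" for x
  proof -
    have "(LINT \<omega>:cyl d n x|mu d. rep \<one>\<^bsub>Linf_alg (mu d)\<^esub> \<omega>) = (LINT \<omega>:cyl d n x|mu d. 1)"
      unfolding set_lebesgue_integral_def
      by (rule integral_cong_AE) (use rep_one[of "mu d"] in \<open>auto elim: eventually_mono\<close>)
    also have "\<dots> = of_real (1 / card (level d n))"
      by (simp add: set_lebesgue_integral_def scaleR_conv_of_real measure_cyl[OF d x])
    finally show ?thesis using x by (auto simp: finite_level)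
  qed
  then show ?thesis unfolding cond_exp_def by (intro restrict_ext) auto
qed

lemma cond_exp2_one:
  assumes d: "inductive_family dX" "inductive_family dY"
  shows "cond_exp2 dX dY n \<one>\<^bsub>Linf_tensor_alg dX dY\<^esub> = \<one>\<^bsub>diag_alg (level dX n \<times> level dY n)\<^esub>"
proof -
  have "\<one>\<^bsub>Linf_tensor_alg dX dY\<^esub> =
      linf_tensor (mu dX) (mu dY) \<one>\<^bsub>Linf_alg (mu dX)\<^esub> \<one>\<^bsub>Linf_alg (mu dY)\<^esub>"
    using linf_tensorI[OF d Linf_zero_one_closed(2) linf_fun_const[of 1] linf_fun_const[of 1]]
      rep_one[of "mu dX \<Otimes>\<^sub>M mu dY"] by (simp add: Linf_alg_def)
  then show ?thesis
    using d by (auto simp: cond_exp2_tensor Linf_zero_one_closed cond_exp_one fun_tensor_def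
        diag_alg_def fun_eq_iff)
qed

text \<open>
For every pair \<open>p\<close> of words, the matrix of values at \<open>p\<close> is positive semidefinite; its Cholesky factors,
assembled over all \<open>p\<close>, form a matrix over the diagonal algebra.
\<close>

lemma ucp_cond_exp2:
  assumes d: "inductive_family dX" "inductive_family dY"
  shows "ucp (Linf_tensor_alg dX dY) (diag_alg (level dX n \<times> level dY n)) (cond_exp2 dX dY n)"
  unfolding ucp_def completely_positive_def
proof (intro conjI allI impI linear_map_cond_exp2 cond_exp2_one d)
  interpret XY: pair_prob_space "mu dX" "mu dY" using d by (rule pair_prob_space_mu)
  let ?L = "level dX n \<times> level dY n"
  fix k P
  assume PL: "\<forall>i<k. \<forall>j<k. P i j \<in> carrier (Linf_tensor_alg dX dY)"
    and P: "positive_matrix (Linf_tensor_alg dX dY) k P"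
  have "\<exists>D. \<forall>i<k. \<forall>j<k. cond_exp2 dX dY n (P i j) p = (\<Sum>l<k. cnj (D l i) * D l j)"
    if pL: "p \<in> ?L" for p
  proof -
    obtain x y where p: "p = (x, y)" "x \<in> level dX n" "y \<in> level dY n" using pL by auto
    let ?c = "real (card (level dX n)) * real (card (level dY n))"
    have "pos_semidef {..<k} (\<lambda>i j. of_real ?c *
        (LINT w:cyl dX n x \<times> cyl dY n y|mu dX \<Otimes>\<^sub>M mu dY. rep (P i j) w))"
      using PL by (intro pos_semidef_scale XY.P.pos_semidef_set_integral P sets_cyl_times) auto
    then show ?thesis
      using p by (elim pos_semidef_factorisation[OF finite_lessThan]) (auto simp: cond_exp2_def)
  qed
  then obtain D where D: "\<And>p i j. p \<in> ?L \<Longrightarrow> i < k \<Longrightarrow> j < k \<Longrightarrow>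
      cond_exp2 dX dY n (P i j) p = (\<Sum>l<k. cnj (D p l i) * D p l j)"
    by metis
  show "positive_matrix (diag_alg ?L) k (\<lambda>i j. cond_exp2 dX dY n (P i j))"
    unfolding diag_alg_def positive_matrix_fun_algebra[OF fun_star_closed_extensional]
  proof (intro exI[of _ "\<lambda>l j. \<lambda>p\<in>?L. D p l j"] conjI allI impI)
    fix i j assume "i < k" "j < k"
    then have "cond_exp2 dX dY n (P i j) p = (\<Sum>l<k. cnj (D p l i) * D p l j)" if "p \<in> ?L" for p
      using D that by blast
    then show "cond_exp2 dX dY n (P i j) =
        (\<lambda>p\<in>?L. \<Sum>l<k. cnj ((\<lambda>p\<in>?L. D p l i) p) * (\<lambda>p\<in>?L. D p l j) p)"
      by (intro extensionalityI[of _ ?L]) (simp add: cond_exp2_def, simp, simp)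
  qed simp
qed

lemma ucp_compose:
  assumes "ucp A B S" "ucp B C T"
  shows "ucp A C (T \<circ> S)"
proof -
  have S: "S a \<in> carrier B" if "a \<in> carrier A" for a
    using assms(1) that by (auto simp: ucp_def completely_positive_def linear_map_def)
  have "linear_map A B S" "linear_map B C T"
    using assms by (simp_all add: ucp_def completely_positive_def)
  then have "linear_map A C (T \<circ> S)"
    using S by (simp add: linear_map_def Pi_iff)
  moreover have "positive_matrix C k (\<lambda>i j. (T \<circ> S) (P i j))"
    if "1 \<le> k" "\<forall>i<k. \<forall>j<k. P i j \<in> carrier A" "positive_matrix A k P" for k P
  proof -
    have "positive_matrix B k (\<lambda>i j. S (P i j))"
      using assms(1) that unfolding ucp_def completely_positive_def by blast
    moreover have "\<forall>i<k. \<forall>j<k. S (P i j) \<in> carrier B" using S that by blast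
    ultimately have "positive_matrix C k (\<lambda>i j. T (S (P i j)))"
      using assms(2) that(1) unfolding ucp_def completely_positive_def by simp
    then show ?thesis by simp
  qed
  ultimately show ?thesis
    using assms unfolding ucp_def completely_positive_def by simp
qed

text \<open>
The embedding is composition with the restriction map, hence a unital *-homomorphism, and such a
map carries a factorisation of a matrix to a factorisation of its image.
\<close>

lemma ucp_cyl_embed2:
  "ucp (diag_alg (level dA n \<times> level dB n)) (C_tensor_alg dA dB) (cyl_embed2 dA dB n)"
  unfolding ucp_def completely_positive_def linear_map_def
proof (intro conjI allI impI ballI)
  let ?L = "level dA n \<times> level dB n" and ?T = "prod_topology (Omega_top dA) (Omega_top dB)"
  let ?r = "\<lambda>w. (restrict (fst w) {..<n}, restrict (snd w) {..<n})"
  have r: "?r w \<in> ?L" if "w \<in> Omega dA \<times> Omega dB" for w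
    using that by (auto intro: restrict_in_level)
  show "cyl_embed2 dA dB n \<in> carrier (diag_alg ?L) \<rightarrow> carrier (C_tensor_alg dA dB)"
    using cyl_embed2_continuous by auto
  show "cyl_embed2 dA dB n (f \<oplus>\<^bsub>diag_alg ?L\<^esub> g) =
      cyl_embed2 dA dB n f \<oplus>\<^bsub>C_tensor_alg dA dB\<^esub> cyl_embed2 dA dB n g" for f g
    using r by (auto simp: cyl_embed2_eq diag_alg_def C_alg_def fun_eq_iff)
  show "cyl_embed2 dA dB n (c \<odot>\<^bsub>diag_alg ?L\<^esub> f) = c \<odot>\<^bsub>C_tensor_alg dA dB\<^esub> cyl_embed2 dA dB n f" for c f
    using r by (auto simp: cyl_embed2_eq diag_alg_def C_alg_def fun_eq_iff)
  show "cyl_embed2 dA dB n \<one>\<^bsub>diag_alg ?L\<^esub> = \<one>\<^bsub>C_tensor_alg dA dB\<^esub>"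
    using r by (auto simp: cyl_embed2_eq diag_alg_def C_alg_def fun_eq_iff)
  fix k P assume "positive_matrix (diag_alg ?L) k P"
  then obtain C where C: "\<And>i j. i < k \<Longrightarrow> j < k \<Longrightarrow>
      P i j = (\<lambda>x\<in>?L. \<Sum>l<k. cnj (C l i x) * C l j x)"
    unfolding diag_alg_def positive_matrix_fun_algebra[OF fun_star_closed_extensional] by blast
  have "cyl_embed2 dA dB n (P i j) = (\<lambda>w\<in>topspace ?T. \<Sum>l<k.
      cnj (cyl_embed2 dA dB n (C l i) w) * cyl_embed2 dA dB n (C l j) w)"
    if "i < k" "j < k" for i j
    using r by (auto simp: cyl_embed2_eq C[OF that] intro!: restrict_ext)
  then show "positive_matrix (C_tensor_alg dA dB) k (\<lambda>i j. cyl_embed2 dA dB n (P i j))"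
    unfolding C_alg_def positive_matrix_fun_algebra[OF fun_star_closed_continuous]
  proof (intro exI[of _ "\<lambda>i j. cyl_embed2 dA dB n (C i j)"] conjI allI impI)
    fix i j
    show "cyl_embed2 dA dB n (C i j) \<in> {f \<in> extensional (topspace ?T). continuous_map ?T euclidean f}"
      by (rule cyl_embed2_continuous[unfolded C_alg_def fun_algebra_sel(1)])
  qed simp
qed

lemma ucp_assoc_family:
  assumes "inductive_family dX" "inductive_family dY"
    and "ucp (C_tensor_alg dA dB) (Linf_tensor_alg dX dY) \<Gamma>"
  shows "ucp (diag_alg (level dA n \<times> level dB n)) (diag_alg (level dX n \<times> level dY n))
    (assoc_family dX dY dA dB \<Gamma> n)"
  using ucp_compose[OF ucp_compose[OF ucp_cyl_embed2 assms(3)] ucp_cond_exp2[OF assms(1,2)]]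
  by (simp add: assoc_family_def o_assoc)

section \<open>No-signalling conditions\<close>

lemma fun_tensor_continuous:
  assumes "f \<in> carrier (C_alg S)" "g \<in> carrier (C_alg T)"
  shows "fun_tensor (topspace S) (topspace T) f g \<in> carrier (C_alg (prod_topology S T))"
proof -
  have "continuous_map (prod_topology S T) euclidean (\<lambda>w. f (fst w))"
    "continuous_map (prod_topology S T) euclidean (\<lambda>w. g (snd w))"
    using assms continuous_map_compose[OF continuous_map_fst, of S euclidean f T]
      continuous_map_compose[OF continuous_map_snd, of T euclidean g S]
    by (simp_all add: C_alg_def o_def)
  then have "continuous_map (prod_topology S T) euclidean (\<lambda>w. f (fst w) * g (snd w))"
    by (simp add: continuous_map_atin tendsto_mult)
  from C_alg_carrierI[OF this] show ?thesis
    by (simp add: fun_tensor_def case_prod_unfold)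
qed

text \<open>
By \<open>ucp_norm_bound\<close> the map \<open>\<Gamma>\<close> is continuous for the uniform norms, so a uniform approximation
of \<open>f\<close> gives one of \<open>\<Gamma> f\<close>.
\<close>

lemma factors_through_closed:
  assumes ucp: "ucp (C_alg T) (Linf_alg N) \<Gamma>" and \<pi>: "\<pi> \<in> N \<rightarrow>\<^sub>M M"
    and f: "f \<in> carrier (C_alg T)"
    and approx: "\<And>e::real. e > 0 \<Longrightarrow> \<exists>h\<in>carrier (C_alg T). (\<forall>x\<in>topspace T. norm (f x - h x) \<le> e) \<and>
      (\<exists>g\<in>borel_measurable M. AE w in N. rep (\<Gamma> h) w = g (\<pi> w))"
  shows "\<exists>g\<in>linf_fun M. AE w in N. rep (\<Gamma> f) w = g (\<pi> w)"
proof (rule factors_through_limit[OF \<pi>])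
  have lin: "linear_map (C_alg T) (Linf_alg N) \<Gamma>"
    using ucp by (simp add: ucp_def completely_positive_def)
  then show "rep (\<Gamma> f) \<in> linf_fun N"
    using f by (intro rep_in_linf_fun) (auto simp: linear_map_def)
  fix e :: real assume "e > 0"
  then obtain h g where h: "h \<in> carrier (C_alg T)" "\<forall>x\<in>topspace T. norm (f x - h x) \<le> e / 2"
    and g: "g \<in> borel_measurable M" "AE w in N. rep (\<Gamma> h) w = g (\<pi> w)"
    using approx[of "e / 2"] by auto
  let ?d = "\<lambda>x\<in>topspace T. 1 * f x + (-1) * h x"
  have "AE w in N. norm (rep (\<Gamma> ?d) w) \<le> 2 * (e / 2)"
  proof (rule ucp_norm_bound[OF ucp])
    show "?d \<in> carrier (C_alg T)"
      using C_alg_continuous[OF f] C_alg_continuous[OF h(1)]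
      by (intro C_alg_carrierI) (simp add: continuous_map_atin tendsto_diff)
  qed (use h(2) in auto)
  with linear_C_Linf_comb[OF lin f h(1), of 1 "-1"] g(2)
  have "AE w in N. norm (rep (\<Gamma> f) w - g (\<pi> w)) \<le> e"
    by eventually_elim simp
  with g(1) show "\<exists>g\<in>borel_measurable M. AE w in N. norm (rep (\<Gamma> f) w - g (\<pi> w)) \<le> e" by blast
qed

lemma assoc_family_tensor:
  "assoc_family dX dY dA dB \<Gamma> n (fun_tensor (level dA n) (level dB n) \<phi> \<psi>) =
   cond_exp2 dX dY n (\<Gamma> (fun_tensor (Omega dA) (Omega dB) (cyl_embed dA n \<phi>) (cyl_embed dB n \<psi>)))"
  by (simp add: assoc_family_def cyl_embed2_tensor)

lemma one_diag_alg: "\<one>\<^bsub>diag_alg S\<^esub> = (\<lambda>x\<in>S. 1)"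
  by (simp add: diag_alg_def)

lemma one_Linf_alg: "\<one>\<^bsub>Linf_alg M\<^esub> = linf_class M (\<lambda>_. 1)"
  by (simp add: Linf_alg_def)

lemma norm_fun_tensor_diff_fst:
  assumes "\<And>u. u \<in> K \<Longrightarrow> norm (f u - f' u) \<le> e" "\<And>v. v \<in> L \<Longrightarrow> g v = 1" "w \<in> K \<times> L"
  shows "norm (fun_tensor K L f g w - fun_tensor K L f' g w) \<le> e"
  using assms by (auto simp: fun_tensor_def)

lemma norm_fun_tensor_diff_snd:
  assumes "\<And>v. v \<in> L \<Longrightarrow> norm (g v - g' v) \<le> e" "\<And>u. u \<in> K \<Longrightarrow> f u = 1" "w \<in> K \<times> L"
  shows "norm (fun_tensor K L f g w - fun_tensor K L f g' w) \<le> e"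
  using assms by (auto simp: fun_tensor_def)

text \<open>
Forward, apply the conditional expectation to \<open>g \<otimes> 1\<close>. Backward, \<open>\<Gamma>(f \<otimes> 1)\<close> is a function of
the first coordinate when \<open>f\<close> is a cylinder function, and then, by density, for every \<open>f\<close>.
\<close>

lemma no_signalling_fst:
  assumes d: "inductive_family dX" "inductive_family dY" "inductive_family dA"
    and ucp: "ucp (C_tensor_alg dA dB) (Linf_tensor_alg dX dY) \<Gamma>"
  shows "(\<lambda>f. \<Gamma> (fun_tensor (Omega dA) (Omega dB) f \<one>\<^bsub>C_alg (Omega_top dB)\<^esub>))
         ` carrier (C_alg (Omega_top dA))
       \<subseteq> (\<lambda>g. linf_tensor (mu dX) (mu dY) g \<one>\<^bsub>Linf_alg (mu dY)\<^esub>) ` carrier (Linf_alg (mu dX)) \<longleftrightarrow>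
    (\<forall>n\<ge>1. (\<lambda>f. assoc_family dX dY dA dB \<Gamma> n
          (fun_tensor (level dA n) (level dB n) f \<one>\<^bsub>diag_alg (level dB n)\<^esub>))
         ` carrier (diag_alg (level dA n))
       \<subseteq> (\<lambda>g. fun_tensor (level dX n) (level dY n) g \<one>\<^bsub>diag_alg (level dY n)\<^esub>)
         ` carrier (diag_alg (level dX n)))"
    (is "?lhs \<longleftrightarrow> ?rhs")
proof
  let ?t = "\<lambda>f. fun_tensor (Omega dA) (Omega dB) f \<one>\<^bsub>C_alg (Omega_top dB)\<^esub>"
  have assoc: "assoc_family dX dY dA dB \<Gamma> n
      (fun_tensor (level dA n) (level dB n) \<phi> \<one>\<^bsub>diag_alg (level dB n)\<^esub>) =
      cond_exp2 dX dY n (\<Gamma> (?t (cyl_embed dA n \<phi>)))" for n \<phi>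
    by (simp only: assoc_family_tensor one_diag_alg cyl_embed_one)
  have t: "?t f \<in> carrier (C_tensor_alg dA dB)" if "f \<in> carrier (C_alg (Omega_top dA))" for f
    using fun_tensor_continuous[OF that one_in_C_alg[of "Omega_top dB"]] by simp
  have \<Gamma>_carrier: "\<Gamma> (?t f) \<in> carrier (Linf_tensor_alg dX dY)" if "f \<in> carrier (C_alg (Omega_top dA))" for f
    using t[OF that] ucp by (auto simp: ucp_def completely_positive_def linear_map_def)
  {
    assume L: ?lhs
    show ?rhs
    proof (intro allI impI image_subsetI)
      fix n \<phi>
      obtain g where g: "g \<in> carrier (Linf_alg (mu dX))"
        "\<Gamma> (?t (cyl_embed dA n \<phi>)) = linf_tensor (mu dX) (mu dY) g \<one>\<^bsub>Linf_alg (mu dY)\<^esub>"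
        using L cyl_embed_continuous[of dA n \<phi>] by blast
      have "cond_exp2 dX dY n (\<Gamma> (?t (cyl_embed dA n \<phi>))) =
          fun_tensor (level dX n) (level dY n) (cond_exp dX n g) \<one>\<^bsub>diag_alg (level dY n)\<^esub>"
        unfolding g(2) cond_exp2_tensor[OF d(1,2) g(1) Linf_zero_one_closed(2)]
          cond_exp_one[OF d(2)] one_diag_alg ..
      moreover have "cond_exp dX n g \<in> carrier (diag_alg (level dX n))"
        by (simp add: cond_exp_def diag_alg_def)
      ultimately show "assoc_family dX dY dA dB \<Gamma> n
          (fun_tensor (level dA n) (level dB n) \<phi> \<one>\<^bsub>diag_alg (level dB n)\<^esub>) \<in>
        (\<lambda>g. fun_tensor (level dX n) (level dY n) g \<one>\<^bsub>diag_alg (level dY n)\<^esub>)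
         ` carrier (diag_alg (level dX n))"
        unfolding assoc by (rule image_eqI)
    qed
  next
    assume R: ?rhs
    have cyl: "\<exists>g\<in>borel_measurable (mu dX).
        AE w in mu dX \<Otimes>\<^sub>M mu dY. rep (\<Gamma> (?t (cyl_embed dA k \<phi>))) w = g (fst w)" for k \<phi>
    proof (rule depends_on_fst_if_cond_exp2[OF d(1,2) \<Gamma>_carrier[OF cyl_embed_continuous]])
      \<comment> \<open>The level must also be at least \<open>1\<close>, where the associated family begins.\<close>
      fix m x y y' assume m: "max k 1 \<le> m"
        and l: "x \<in> level dX m" "y \<in> level dY m" "y' \<in> level dY m"
      obtain \<phi>' where \<phi>': "\<phi>' \<in> extensional (level dA m)" "cyl_embed dA m \<phi>' = cyl_embed dA k \<phi>"
        using cyl_embed_refine[of k m] m by (metis max.bounded_iff)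
      have "\<phi>' \<in> carrier (diag_alg (level dA m))" using \<phi>'(1) by (simp add: diag_alg_def)
      with R m obtain h where "assoc_family dX dY dA dB \<Gamma> m
          (fun_tensor (level dA m) (level dB m) \<phi>' \<one>\<^bsub>diag_alg (level dB m)\<^esub>) =
          fun_tensor (level dX m) (level dY m) h \<one>\<^bsub>diag_alg (level dY m)\<^esub>"
        by (fastforce simp del: One_nat_def)
      then have "cond_exp2 dX dY m (\<Gamma> (?t (cyl_embed dA k \<phi>))) =
          fun_tensor (level dX m) (level dY m) h \<one>\<^bsub>diag_alg (level dY m)\<^esub>"
        unfolding assoc \<phi>'(2) .
      then show "cond_exp2 dX dY m (\<Gamma> (?t (cyl_embed dA k \<phi>))) (x, y) =
          cond_exp2 dX dY m (\<Gamma> (?t (cyl_embed dA k \<phi>))) (x, y')"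
        using l by (simp add: fun_tensor_def one_diag_alg)
    qed
    show ?lhs
    proof (rule image_subsetI)
      fix f assume f: "f \<in> carrier (C_alg (Omega_top dA))"
      have "\<exists>g\<in>linf_fun (mu dX). AE w in mu dX \<Otimes>\<^sub>M mu dY. rep (\<Gamma> (?t f)) w = g (fst w)"
      proof (rule factors_through_closed[OF ucp measurable_fst t[OF f]])
        fix e :: real assume "e > 0"
        then obtain k \<phi> where "\<And>\<omega>. \<omega> \<in> Omega dA \<Longrightarrow> norm (f \<omega> - cyl_embed dA k \<phi> \<omega>) \<le> e"
          using cyl_embed_dense[OF d(3) C_alg_continuous[OF f]] by blast
        then have "norm (?t f w - ?t (cyl_embed dA k \<phi>) w) \<le> e" if "w \<in> Omega dA \<times> Omega dB" for w
          by (rule norm_fun_tensor_diff_fst[OF _ _ that]) (simp_all add: C_alg_def)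
        then show "\<exists>h\<in>carrier (C_tensor_alg dA dB).
            (\<forall>w\<in>topspace (prod_topology (Omega_top dA) (Omega_top dB)). norm (?t f w - h w) \<le> e) \<and>
            (\<exists>g\<in>borel_measurable (mu dX). AE w in mu dX \<Otimes>\<^sub>M mu dY. rep (\<Gamma> h) w = g (fst w))"
          using cyl[of k \<phi>] by (intro bexI[OF _ t[OF cyl_embed_continuous[of dA k \<phi>]]]) auto
      qed
      then obtain g where g: "g \<in> linf_fun (mu dX)"
        "AE w in mu dX \<Otimes>\<^sub>M mu dY. rep (\<Gamma> (?t f)) w = g (fst w)" by blast
      have "\<Gamma> (?t f) = linf_tensor (mu dX) (mu dY) (linf_class (mu dX) g) \<one>\<^bsub>Linf_alg (mu dY)\<^esub>"
        unfolding one_Linf_alg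
        by (rule linf_tensorI[OF d(1,2) \<Gamma>_carrier[OF f] g(1) linf_fun_const]) (use g(2) in simp)
      then show "\<Gamma> (?t f) \<in>
          (\<lambda>g. linf_tensor (mu dX) (mu dY) g \<one>\<^bsub>Linf_alg (mu dY)\<^esub>) ` carrier (Linf_alg (mu dX))"
        using linf_class_in_carrier[OF g(1)] by (rule image_eqI)
    qed
  }
qed

lemma no_signalling_snd:
  assumes d: "inductive_family dX" "inductive_family dY" "inductive_family dB"
    and ucp: "ucp (C_tensor_alg dA dB) (Linf_tensor_alg dX dY) \<Gamma>"
  shows "(\<lambda>f. \<Gamma> (fun_tensor (Omega dA) (Omega dB) \<one>\<^bsub>C_alg (Omega_top dA)\<^esub> f))
         ` carrier (C_alg (Omega_top dB))
       \<subseteq> (\<lambda>g. linf_tensor (mu dX) (mu dY) \<one>\<^bsub>Linf_alg (mu dX)\<^esub> g) ` carrier (Linf_alg (mu dY)) \<longleftrightarrow>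
    (\<forall>n\<ge>1. (\<lambda>f. assoc_family dX dY dA dB \<Gamma> n
          (fun_tensor (level dA n) (level dB n) \<one>\<^bsub>diag_alg (level dA n)\<^esub> f))
         ` carrier (diag_alg (level dB n))
       \<subseteq> (\<lambda>g. fun_tensor (level dX n) (level dY n) \<one>\<^bsub>diag_alg (level dX n)\<^esub> g)
         ` carrier (diag_alg (level dY n)))"
    (is "?lhs \<longleftrightarrow> ?rhs")
proof
  let ?t = "\<lambda>f. fun_tensor (Omega dA) (Omega dB) \<one>\<^bsub>C_alg (Omega_top dA)\<^esub> f"
  have assoc: "assoc_family dX dY dA dB \<Gamma> n
      (fun_tensor (level dA n) (level dB n) \<one>\<^bsub>diag_alg (level dA n)\<^esub> \<phi>) =
      cond_exp2 dX dY n (\<Gamma> (?t (cyl_embed dB n \<phi>)))" for n \<phi>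
    by (simp only: assoc_family_tensor one_diag_alg cyl_embed_one)
  have t: "?t f \<in> carrier (C_tensor_alg dA dB)" if "f \<in> carrier (C_alg (Omega_top dB))" for f
    using fun_tensor_continuous[OF one_in_C_alg[of "Omega_top dA"] that] by simp
  have \<Gamma>_carrier: "\<Gamma> (?t f) \<in> carrier (Linf_tensor_alg dX dY)" if "f \<in> carrier (C_alg (Omega_top dB))" for f
    using t[OF that] ucp by (auto simp: ucp_def completely_positive_def linear_map_def)
  {
    assume L: ?lhs
    show ?rhs
    proof (intro allI impI image_subsetI)
      fix n \<phi>
      obtain g where g: "g \<in> carrier (Linf_alg (mu dY))"
        "\<Gamma> (?t (cyl_embed dB n \<phi>)) = linf_tensor (mu dX) (mu dY) \<one>\<^bsub>Linf_alg (mu dX)\<^esub> g"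
        using L cyl_embed_continuous[of dB n \<phi>] by blast
      have "cond_exp2 dX dY n (\<Gamma> (?t (cyl_embed dB n \<phi>))) =
          fun_tensor (level dX n) (level dY n) \<one>\<^bsub>diag_alg (level dX n)\<^esub> (cond_exp dY n g)"
        unfolding g(2) cond_exp2_tensor[OF d(1,2) Linf_zero_one_closed(2) g(1)]
          cond_exp_one[OF d(1)] one_diag_alg ..
      moreover have "cond_exp dY n g \<in> carrier (diag_alg (level dY n))"
        by (simp add: cond_exp_def diag_alg_def)
      ultimately show "assoc_family dX dY dA dB \<Gamma> n
          (fun_tensor (level dA n) (level dB n) \<one>\<^bsub>diag_alg (level dA n)\<^esub> \<phi>) \<in>
        (\<lambda>g. fun_tensor (level dX n) (level dY n) \<one>\<^bsub>diag_alg (level dX n)\<^esub> g)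
         ` carrier (diag_alg (level dY n))"
        unfolding assoc by (rule image_eqI)
    qed
  next
    assume R: ?rhs
    have cyl: "\<exists>g\<in>borel_measurable (mu dY).
        AE w in mu dX \<Otimes>\<^sub>M mu dY. rep (\<Gamma> (?t (cyl_embed dB k \<phi>))) w = g (snd w)" for k \<phi>
    proof (rule depends_on_snd_if_cond_exp2[OF d(1,2) \<Gamma>_carrier[OF cyl_embed_continuous]])
      \<comment> \<open>The level must also be at least \<open>1\<close>, where the associated family begins.\<close>
      fix m x x' y assume m: "max k 1 \<le> m"
        and l: "x \<in> level dX m" "x' \<in> level dX m" "y \<in> level dY m"
      obtain \<phi>' where \<phi>': "\<phi>' \<in> extensional (level dB m)" "cyl_embed dB m \<phi>' = cyl_embed dB k \<phi>"
        using cyl_embed_refine[of k m] m by (metis max.bounded_iff)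
      have "\<phi>' \<in> carrier (diag_alg (level dB m))" using \<phi>'(1) by (simp add: diag_alg_def)
      with R m obtain h where "assoc_family dX dY dA dB \<Gamma> m
          (fun_tensor (level dA m) (level dB m) \<one>\<^bsub>diag_alg (level dA m)\<^esub> \<phi>') =
          fun_tensor (level dX m) (level dY m) \<one>\<^bsub>diag_alg (level dX m)\<^esub> h"
        by (fastforce simp del: One_nat_def)
      then have "cond_exp2 dX dY m (\<Gamma> (?t (cyl_embed dB k \<phi>))) =
          fun_tensor (level dX m) (level dY m) \<one>\<^bsub>diag_alg (level dX m)\<^esub> h"
        unfolding assoc \<phi>'(2) .
      then show "cond_exp2 dX dY m (\<Gamma> (?t (cyl_embed dB k \<phi>))) (x, y) =
          cond_exp2 dX dY m (\<Gamma> (?t (cyl_embed dB k \<phi>))) (x', y)"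
        using l by (simp add: fun_tensor_def one_diag_alg)
    qed
    show ?lhs
    proof (rule image_subsetI)
      fix f assume f: "f \<in> carrier (C_alg (Omega_top dB))"
      have "\<exists>g\<in>linf_fun (mu dY). AE w in mu dX \<Otimes>\<^sub>M mu dY. rep (\<Gamma> (?t f)) w = g (snd w)"
      proof (rule factors_through_closed[OF ucp measurable_snd t[OF f]])
        fix e :: real assume "e > 0"
        then obtain k \<phi> where "\<And>\<omega>. \<omega> \<in> Omega dB \<Longrightarrow> norm (f \<omega> - cyl_embed dB k \<phi> \<omega>) \<le> e"
          using cyl_embed_dense[OF d(3) C_alg_continuous[OF f]] by blast
        then have "norm (?t f w - ?t (cyl_embed dB k \<phi>) w) \<le> e" if "w \<in> Omega dA \<times> Omega dB" for w
          by (rule norm_fun_tensor_diff_snd[OF _ _ that]) (simp_all add: C_alg_def)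
        then show "\<exists>h\<in>carrier (C_tensor_alg dA dB).
            (\<forall>w\<in>topspace (prod_topology (Omega_top dA) (Omega_top dB)). norm (?t f w - h w) \<le> e) \<and>
            (\<exists>g\<in>borel_measurable (mu dY). AE w in mu dX \<Otimes>\<^sub>M mu dY. rep (\<Gamma> h) w = g (snd w))"
          using cyl[of k \<phi>] by (intro bexI[OF _ t[OF cyl_embed_continuous[of dB k \<phi>]]]) auto
      qed
      then obtain g where g: "g \<in> linf_fun (mu dY)"
        "AE w in mu dX \<Otimes>\<^sub>M mu dY. rep (\<Gamma> (?t f)) w = g (snd w)" by blast
      have "\<Gamma> (?t f) = linf_tensor (mu dX) (mu dY) \<one>\<^bsub>Linf_alg (mu dX)\<^esub> (linf_class (mu dY) g)"
        unfolding one_Linf_alg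
        by (rule linf_tensorI[OF d(1,2) \<Gamma>_carrier[OF f] linf_fun_const g(1)]) (use g(2) in simp)
      then show "\<Gamma> (?t f) \<in>
          (\<lambda>g. linf_tensor (mu dX) (mu dY) \<one>\<^bsub>Linf_alg (mu dX)\<^esub> g) ` carrier (Linf_alg (mu dY))"
        using linf_class_in_carrier[OF g(1)] by (rule image_eqI)
    qed
  }
qed

theorem proposition4p2:
  fixes dX dY dA dB :: "nat \<Rightarrow> nat"
    and \<Gamma> :: "((nat \<Rightarrow> nat) \<times> (nat \<Rightarrow> nat) \<Rightarrow> complex) \<Rightarrow>
              ((nat \<Rightarrow> nat) \<times> (nat \<Rightarrow> nat) \<Rightarrow> complex) set"
  assumes "inductive_family dX" "inductive_family dY"
    and "inductive_family dA" "inductive_family dB"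
    and "ucp (C_tensor_alg dA dB) (Linf_tensor_alg dX dY) \<Gamma>"
  shows "\<Gamma> \<in> C_ns dX dY dA dB \<longleftrightarrow>
    (\<forall>n\<ge>1. assoc_family dX dY dA dB \<Gamma> n
       \<in> C_ns_fin (level dX n) (level dY n) (level dA n) (level dB n))"
  unfolding C_ns_def C_ns_fin_def mem_Collect_eq no_signalling_fst[OF assms(1,2,3,5)]
    no_signalling_snd[OF assms(1,2,4,5)]
  by (simp only: assms(5) ucp_assoc_family[OF assms(1,2,5)] simp_thms imp_conjR all_conj_distrib)

end
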